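(* Let $\ell$ be a positive number, let $\Omega\subset\mathbb R^{n+1}_+$ be a backward time connected domain, and let $\varphi_0,\varphi_1$ be functions on $\widetilde\Omega$. Suppose that the functions $v_0,v_1\in C^{m,2}_{x,t}(\overline{\Omega_\phi})$ solve, for $i=0,1$, the problem $$\partial_t^2v_i-A(x,\partial_x)v_i=0\quad\text{for all }(x,t)\in\Omega_\phi,$$ $$v_i(x,0)=\varphi_i(x),\qquad\partial_tv_i(x,0)=0\quad\text{for all }x\in\widetilde\Omega.$$ Then the function $u=K_0v_0+K_1v_1\in C^{m,2}_{x,t}(\Omega)$ solves the problem $$\left(\partial_t^2-t^\ell A(x,\partial_x)\right)u=0\quad\text{for all }(x,t)\in\Omega,$$ $$u(x,0)=\varphi_0(x),\qquad\partial_tu(x,0)=\varphi_1(x)\quad\text{for all }x\in\widetilde\Omega.$$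
   Context: $\mathbb R^{n+1}_+=\{(x,t): x\in\mathbb R^n,\ t>0\}$. A set $\Omega\subseteq\overline{\mathbb R^{n+1}_+}$ is backward time (line-)connected (to $t=0$) if for every $(x,t)\in\Omega$ the segment $\{(x,s): s\in(0,t]\}$ is contained in $\Omega$. A domain is a connected open set. $\widetilde\Omega=\pi_x(\Omega)\subseteq\mathbb R^n$ is the projection of $\Omega$ to the $x$-space. $\phi(t)=\frac{2}{\ell+2}t^{(\ell+2)/2}$, $\gamma=\frac{\ell}{2(\ell+2)}$. The $\phi$-image of $\Omega$ is $\Omega_\phi=\bigcup_{(x,t)\in\Omega}\{(x,\tau):\tau\in(0,\phi(t)]\}$. $A(x,\partial_x)=\sum_{|\alpha|\le m}a_\alpha(x)\partial_x^\alpha$ is a linear partial differential operator of order $m$ in $x$ with coefficients $a_\alpha\in C^\infty(\widetilde\Omega)$. $C^{m,2}_{x,t}(\cdot)$ denotes functions continuous together with their partial derivatives up to order $m$ in $x$ and up to order $2$ in $t$ (on a closed set: extending continuously to it). Values at $t=0$ are understood by continuous extension. The operators are $$(K_0v)(x,t)=2^{2-2\gamma}\frac{\Gamma(2\gamma)}{\Gamma^2(\gamma)}\int_0^1v(x,\phi(t)s)(1-s^2)^{\gamma-1}ds,$$ $$(K_1v)(x,t)=t\,2^{2\gamma}\frac{\Gamma(2-2\gamma)}{\Gamma^2(1-\gamma)}\int_0^1v(x,\phi(t)s)(1-s^2)^{-\gamma}ds.$$ *)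

theory Defs
  imports "HOL-Analysis.Analysis"
begin

section \<open>Partial derivatives and the spaces $C^{m,2}_{x,t}$\<close>

text \<open>
  Partial derivatives are iterated one-variable derivatives along fixed directions. They are only
  ever evaluated on open sets, so values of the functions outside the set are irrelevant.
\<close>

definition dir_deriv ::
    "'a::real_normed_vector \<Rightarrow> ('a \<Rightarrow> 'b::real_normed_vector) \<Rightarrow> 'a \<Rightarrow> 'b" where
  "dir_deriv e f p = vector_derivative (\<lambda>s. f (p + s *\<^sub>R e)) (at 0)"

definition iter_deriv ::
    "'a::real_normed_vector list \<Rightarrow> ('a \<Rightarrow> 'b::real_normed_vector) \<Rightarrow> 'a \<Rightarrow> 'b" where
  "iter_deriv es f = foldr dir_deriv es f"

text \<open>
  \<open>Ck_along E k U f\<close>: on the open set \<open>U\<close>, all iterated derivatives of \<open>f\<close> of order up to \<open>k\<close>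
  along directions from \<open>E\<close> (in any order) exist and are continuous, including \<open>f\<close> itself.
  Existence is required separately because \<open>vector_derivative\<close> is total.
\<close>

definition Ck_along ::
    "'a::real_normed_vector set \<Rightarrow> nat \<Rightarrow> 'a set \<Rightarrow> ('a \<Rightarrow> 'b::real_normed_vector) \<Rightarrow> bool" where
  "Ck_along E k U f \<longleftrightarrow>
     (\<forall>es. set es \<subseteq> E \<and> length es \<le> k \<longrightarrow> continuous_on U (iter_deriv es f)) \<and>
     (\<forall>e es. e \<in> E \<and> set es \<subseteq> E \<and> length es < k \<longrightarrow>
        (\<forall>p\<in>U. (\<lambda>s. iter_deriv es f (p + s *\<^sub>R e)) differentiable (at 0)))"

definition Cinf :: "(real^'n) set \<Rightarrow> (real^'n \<Rightarrow> 'b::real_normed_vector) \<Rightarrow> bool" where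
  "Cinf U f \<longleftrightarrow> (\<forall>k. Ck_along (range (\<lambda>i. axis i 1)) k U f)"

definition x_dir :: "'n::finite \<Rightarrow> (real^'n) \<times> real" where
  "x_dir i = (axis i 1, 0)"

definition t_dir :: "(real^'n) \<times> real" where
  "t_dir = (0, 1)"

definition Cm2 ::
    "nat \<Rightarrow> ((real^'n) \<times> real) set \<Rightarrow> ((real^'n) \<times> real \<Rightarrow> 'b::real_normed_vector) \<Rightarrow> bool" where
  "Cm2 m U f \<longleftrightarrow> Ck_along (range x_dir) m U f \<and> Ck_along {t_dir} 2 U f"

text \<open>
  The space $C^{m,2}_{x,t}(\overline U)$ for open \<open>U\<close>: the function and its derivatives extend
  continuously from \<open>U\<close> to the closure.
\<close>

definition Cm2_closure ::
    "nat \<Rightarrow> ((real^'n) \<times> real) set \<Rightarrow> ((real^'n) \<times> real \<Rightarrow> 'b::real_normed_vector) \<Rightarrow> bool" where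
  "Cm2_closure m U f \<longleftrightarrow> Cm2 m U f \<and>
     (\<forall>es. (set es \<subseteq> range x_dir \<and> length es \<le> m) \<or> (set es \<subseteq> {t_dir} \<and> length es \<le> 2) \<longrightarrow>
        (\<exists>g. continuous_on (closure U) g \<and> (\<forall>p\<in>U. g p = iter_deriv es f p)))"

section \<open>The operator $A(x,\partial_x)$\<close>

text \<open>
  A multi-index is a function \<open>\<alpha> :: 'n \<Rightarrow> nat\<close>. To take the derivative $\partial_x^\alpha$ one
  has to fix an order of differentiation; \<open>index_list \<alpha>\<close> is such an order. The choice does not
  matter for functions of class $C^m$ in \<open>x\<close>, \<open>m \<ge> |\<alpha>|\<close>.
\<close>

definition index_list :: "('n::finite \<Rightarrow> nat) \<Rightarrow> 'n list" where
  "index_list \<alpha> = (SOME is. \<forall>i. count_list is i = \<alpha> i)"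

lemma count_index_list: "count_list (index_list \<alpha>) i = \<alpha> i"
proof -
  obtain xs :: "'a list" where xs: "mset xs = Abs_multiset \<alpha>"
    using ex_mset by blast
  have "count_list xs j = \<alpha> j" for j
    by (simp add: count_mset[symmetric] xs)
  then have "\<exists>is. \<forall>i. count_list is i = \<alpha> i" by blast
  from someI_ex[OF this] show ?thesis
    unfolding index_list_def by blast
qed

definition partial_x ::
    "('n::finite \<Rightarrow> nat) \<Rightarrow> ((real^'n) \<times> real \<Rightarrow> complex) \<Rightarrow> (real^'n) \<times> real \<Rightarrow> complex" where
  "partial_x \<alpha> f = iter_deriv (map x_dir (index_list \<alpha>)) f"

definition multi_indices :: "nat \<Rightarrow> ('n::finite \<Rightarrow> nat) set" where
  "multi_indices m = {\<alpha>. (\<Sum>i\<in>UNIV. \<alpha> i) \<le> m}"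

lemma finite_multi_indices: "finite (multi_indices m :: ('n::finite \<Rightarrow> nat) set)"
proof (rule finite_subset)
  show "(multi_indices m :: ('n \<Rightarrow> nat) set) \<subseteq> PiE UNIV (\<lambda>_. {..m})"
  proof
    fix \<alpha> :: "'n \<Rightarrow> nat" assume "\<alpha> \<in> multi_indices m"
    then have "\<alpha> i \<le> m" for i
      using member_le_sum[of i UNIV \<alpha>] by (simp add: multi_indices_def)
    then show "\<alpha> \<in> PiE UNIV (\<lambda>_. {..m})" by (simp add: PiE_UNIV_domain Pi_iff)
  qed
qed (simp add: finite_PiE)

definition diff_op ::
    "nat \<Rightarrow> (('n::finite \<Rightarrow> nat) \<Rightarrow> real^'n \<Rightarrow> complex) \<Rightarrow>
      ((real^'n) \<times> real \<Rightarrow> complex) \<Rightarrow> (real^'n) \<times> real \<Rightarrow> complex" where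
  "diff_op m a f p = (\<Sum>\<alpha>\<in>multi_indices m. a \<alpha> (fst p) * partial_x \<alpha> f p)"

section \<open>Domains\<close>

definition upper_half_space :: "((real^'n) \<times> real) set" where
  "upper_half_space = {(x, t). t > 0}"

definition backward_time_connected :: "((real^'n) \<times> real) set \<Rightarrow> bool" where
  "backward_time_connected \<Omega> \<longleftrightarrow> (\<forall>(x, t)\<in>\<Omega>. {(x, s) |s. s \<in> {0<..t}} \<subseteq> \<Omega>)"

definition phi :: "real \<Rightarrow> real \<Rightarrow> real" where
  "phi l t = 2 / (l + 2) * t powr ((l + 2) / 2)"

definition gam :: "real \<Rightarrow> real" where
  "gam l = l / (2 * (l + 2))"

definition phi_image :: "real \<Rightarrow> ((real^'n) \<times> real) set \<Rightarrow> ((real^'n) \<times> real) set" where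
  "phi_image l \<Omega> = (\<Union>(x, t)\<in>\<Omega>. {(x, \<tau>) |\<tau>. \<tau> \<in> {0<..phi l t}})"

section \<open>The integral operators\<close>

text \<open>
  The integrands are only relevant for \<open>0 < s < 1\<close>; the endpoints are a null set.
\<close>

definition K0 ::
    "real \<Rightarrow> ((real^'n) \<times> real \<Rightarrow> complex) \<Rightarrow> (real^'n) \<times> real \<Rightarrow> complex" where
  "K0 l v = (\<lambda>(x, t).
     (2 powr (2 - 2 * gam l) * (Gamma (2 * gam l) / (Gamma (gam l))\<^sup>2)) *\<^sub>R
     (LINT s:{0..1}|lborel. (1 - s\<^sup>2) powr (gam l - 1) *\<^sub>R v (x, phi l t * s)))"

definition K1 ::
    "real \<Rightarrow> ((real^'n) \<times> real \<Rightarrow> complex) \<Rightarrow> (real^'n) \<times> real \<Rightarrow> complex" where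
  "K1 l v = (\<lambda>(x, t).
     (t * 2 powr (2 * gam l) * (Gamma (2 - 2 * gam l) / (Gamma (1 - gam l))\<^sup>2)) *\<^sub>R
     (LINT s:{0..1}|lborel. (1 - s\<^sup>2) powr (- gam l) *\<^sub>R v (x, phi l t * s)))"

end

theory Submission
  imports Defs
begin

text \<open>
  Both operators average \<open>v\<close> along the vertical segment below \<open>(x, \<phi>(t))\<close>: up to a constant, and
  up to a factor \<open>t\<close> in the second case, they are
  $\int_0^1 v(x, \phi(t) s)\, d\mu_b(s)$ with $d\mu_b = (1 - s^2)^{b-1} ds$, where \<open>b = \<gamma>\<close> for the
  first and \<open>b = 1 - \<gamma>\<close> for the second. Write $I_k f(x,t) = \int_0^1 s^k f(x, \phi(t)s)\, d\mu_b(s)$.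

  Derivatives in \<open>x\<close> pass under the integral, while a derivative in \<open>t\<close> produces a factor \<open>s\<close> and
  $\phi'(t) = t^{\ell/2}$, so that $\partial_t I_k f = t^{\ell/2} I_{k+1} \partial_t f$
  (\<open>avg_x_deriv\<close>, \<open>avg_t_deriv\<close>). The integrands are uniformly dominated near each point of the domain
  because the derivatives of \<open>v\<close> extend continuously to the closure and are therefore bounded along
  whole segments, down to time 0 (\<open>bounded_along_rays\<close>).

  Hence for $w = (\alpha + \beta t) I_0 v$ the derivative $\partial_t^2 w$ is a combination of
  $I_1 v_t$ and $I_2 v_{tt}$, the latter with coefficient $(\alpha + \beta t) t^\ell$. The weight
  satisfies $-2bs(1-s^2)^{b-1} = \frac{d}{ds}(1-s^2)^b$, and integrating by parts turns the former into
  $2b\, I_1 v_t = \phi(t)\,(I_0 - I_2) v_{tt}$; the boundary term at \<open>s = 0\<close> vanishes because the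
  initial velocity of \<open>v\<close> is zero (\<open>avg_by_parts\<close>). If the coefficients match, which is the
  Euler--Poisson--Darboux relation between \<open>b\<close> and $\alpha + \beta t$, the two $I_2$ terms cancel and
  $\partial_t^2 w = (\alpha + \beta t) t^\ell I_0 v_{tt} = (\alpha + \beta t) t^\ell I_0 A v = t^\ell A w$.
  The relation holds for the constant factor with \<open>b = \<gamma>\<close> and for the factor \<open>t\<close> with
  \<open>b = 1 - \<gamma>\<close>. As \<open>t\<close> tends to 0 the averages of \<open>v\<close> tend to its initial value times the mass of
  $\mu_b$, which the Gamma factors normalise to 1, so the first term contributes the initial position
  and the second the initial velocity (\<open>weighted_avg_solves\<close>).
\<close>

section \<open>Differentiation under the integral sign\<close>

text \<open>
  Dominated convergence is applied to the remainder of the first-order expansion in the parameter,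
  divided by the increment; by the mean value inequality this quotient is at most \<open>2 * B\<close>.
\<close>

lemma has_vector_derivative_integral_param:
  fixes F F' :: "real \<Rightarrow> 'a \<Rightarrow> 'b::{banach, second_countable_topology}"
  assumes M: "finite_measure M" and \<delta>: "\<delta> > 0"
    and int: "\<And>r. r \<in> ball r0 \<delta> \<Longrightarrow> integrable M (F r)"
    and int': "integrable M (F' r0)"
    and der: "\<And>r s. r \<in> ball r0 \<delta> \<Longrightarrow> s \<in> space M \<Longrightarrow>
                ((\<lambda>r. F r s) has_vector_derivative F' r s) (at r)"
    and bd: "\<And>r s. r \<in> ball r0 \<delta> \<Longrightarrow> s \<in> space M \<Longrightarrow> norm (F' r s) \<le> B"
  shows "((\<lambda>r. \<integral>s. F r s \<partial>M) has_vector_derivative (\<integral>s. F' r0 s \<partial>M)) (at r0)"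
proof -
  interpret finite_measure M by (rule M)
  let ?S = "ball r0 \<delta>"
  \<comment> \<open>the quotient whose limit is zero by definition of the derivative\<close>
  define R where "R r s = norm (F r s - F r0 s - (r - r0) *\<^sub>R F' r0 s) / norm (r - r0)" for r s
  have r0: "r0 \<in> ?S" using \<delta> by simp
  have intR: "integrable M (R r)" if "r \<in> ?S" for r
    unfolding R_def using int[OF that] int[OF r0] int'
    by (intro integrable_divide integrable_norm Bochner_Integration.integrable_diff integrable_scaleR_right) auto
  have RB: "R r s \<le> 2 * B" if r: "r \<in> ?S" "r \<noteq> r0" and s: "s \<in> space M" for r s
  proof -
    have "norm (F r s - F r0 s) \<le> B * norm (r - r0)"
    proof (rule differentiable_bound[where S = ?S and f = "\<lambda>r. F r s" and f' = "\<lambda>r h. h *\<^sub>R F' r s"])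
      show "((\<lambda>r. F r s) has_derivative (\<lambda>h. h *\<^sub>R F' r s)) (at r within ?S)" if "r \<in> ?S" for r
        using der[OF that s] by (simp add: has_vector_derivative_def has_derivative_at_withinI)
      show "onorm (\<lambda>h. h *\<^sub>R F' r s) \<le> B" if "r \<in> ?S" for r
        using bd[OF that s] by (intro onorm_le) (simp add: mult.commute[of B] mult_left_mono)
    qed (use r r0 in auto)
    moreover have "norm ((r - r0) *\<^sub>R F' r0 s) \<le> B * norm (r - r0)"
      using bd[OF r0 s] by (simp add: mult.commute[of B] mult_left_mono)
    ultimately have "norm (F r s - F r0 s - (r - r0) *\<^sub>R F' r0 s) \<le> 2 * B * norm (r - r0)"
      using norm_triangle_ineq4[of "F r s - F r0 s" "(r - r0) *\<^sub>R F' r0 s"] by linarith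
    then show ?thesis
      unfolding R_def using r by (simp add: divide_le_eq)
  qed
  have lim: "((\<lambda>r. \<integral>s. R r s \<partial>M) \<longlongrightarrow> 0) (at r0 within ?S)"
    unfolding tendsto_at_iff_sequentially
  proof (intro allI impI)
    fix X assume X: "\<forall>i. X i \<in> ?S - {r0}" "X \<longlonglongrightarrow> r0"
    have "(\<lambda>i. \<integral>s. R (X i) s \<partial>M) \<longlonglongrightarrow> (\<integral>s. 0 \<partial>M)"
    proof (rule integral_dominated_convergence[where w = "\<lambda>_. 2 * B"])
      show "R (X i) \<in> borel_measurable M" for i
        using intR[of "X i"] X(1) by auto
      show "AE s in M. (\<lambda>i. R (X i) s) \<longlonglongrightarrow> 0"
      proof (rule AE_I2)
        fix s assume "s \<in> space M"
        from der[OF r0 this] have "((\<lambda>r. R r s) \<longlongrightarrow> 0) (at r0 within ?S)"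
          using r0 by (simp add: has_vector_derivative_def has_derivative_iff_norm R_def at_within_open[OF r0])
        then show "(\<lambda>i. R (X i) s) \<longlonglongrightarrow> 0"
          using X by (simp add: tendsto_at_iff_sequentially comp_def)
      qed
      show "AE s in M. norm (R (X i) s) \<le> 2 * B" for i
        using RB[of "X i"] X(1) by (auto simp: R_def)
    qed auto
    then show "((\<lambda>r. \<integral>s. R r s \<partial>M) \<circ> X) \<longlonglongrightarrow> 0" by (simp add: comp_def)
  qed
  let ?G = "\<lambda>r. \<integral>s. F r s \<partial>M"
  have "((\<lambda>r. norm (?G r - ?G r0 - (r - r0) *\<^sub>R (\<integral>s. F' r0 s \<partial>M)) / norm (r - r0)) \<longlongrightarrow> 0)
          (at r0 within ?S)"
  proof (rule Lim_null_comparison[OF _ lim], unfold eventually_at_filter, intro always_eventually allI impI)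
    fix r assume r: "r \<noteq> r0" "r \<in> ?S"
    have "?G r - ?G r0 - (r - r0) *\<^sub>R (\<integral>s. F' r0 s \<partial>M)
            = (\<integral>s. F r s - F r0 s - (r - r0) *\<^sub>R F' r0 s \<partial>M)"
      using int[OF r(2)] int[OF r0] int' by simp
    also have "norm \<dots> \<le> (\<integral>s. norm (F r s - F r0 s - (r - r0) *\<^sub>R F' r0 s) \<partial>M)"
      by (rule integral_norm_bound)
    finally show "norm (norm (?G r - ?G r0 - (r - r0) *\<^sub>R (\<integral>s. F' r0 s \<partial>M)) / norm (r - r0))
        \<le> (\<integral>s. R r s \<partial>M)"
      unfolding R_def by (simp add: divide_right_mono)
  qed
  then show ?thesis
    using r0 by (simp add: has_vector_derivative_def has_derivative_iff_norm at_within_open[OF r0] bounded_linear_scaleR_left)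
qed

section \<open>The weights of the integral operators\<close>

text \<open>
  The underlying space is the open interval, not the real line. An integrand
  $s \mapsto v(x, \tau s)$ is controlled only for positive \<open>s\<close>, and on the interval its continuity
  already gives measurability.
\<close>

definition weight_measure :: "real \<Rightarrow> real measure" where
  "weight_measure b =
     density (restrict_space lborel {0<..<1}) (\<lambda>s. ennreal ((1 - s\<^sup>2) powr (b - 1)))"

lemma space_weight_measure [simp]: "space (weight_measure b) = {0<..<1}"
  by (simp add: weight_measure_def space_restrict_space)

lemma measurable_weight_measure:
  "borel_measurable (weight_measure b) = borel_measurable (restrict_space borel {0<..<1})"
  by (rule measurable_cong_sets) (simp_all add: weight_measure_def sets_restrict_space)

lemma weight_measurable [measurable]:
  "(\<lambda>s::real. (1 - s\<^sup>2) powr (b - 1)) \<in> borel_measurable (restrict_space lborel {0<..<1})"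
  by (intro measurable_restrict_space1) measurable

text \<open>
  The integrand is even, so the integral is half of that over \<open>{-1..1}\<close>. There
  $1 - s^2 = (1 - s)(1 + s)$, and the substitution \<open>s = 2 * t - 1\<close> leads to the symmetric Beta
  integral \<open>Beta b b\<close>.
\<close>

lemma has_integral_weight:
  assumes "b > 0"
  shows "((\<lambda>s. (1 - s\<^sup>2) powr (b - 1)) has_integral
           (2 powr (2 * b - 2) * (Gamma b)\<^sup>2 / Gamma (2 * b))) {0..1::real}"
proof -
  let ?w = "\<lambda>s::real. (1 - s\<^sup>2) powr (b - 1)"
  let ?g = "\<lambda>t::real. t powr (b - 1) * (1 - t) powr (b - 1)"
  have "((\<lambda>s. ?g ((1/2) *\<^sub>R s + 1/2)) has_integral 2 * Beta b b) {-1..1}"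
    using has_integral_affinity'[OF has_integral_Beta_real[OF assms assms, folded cbox_interval], of "1/2" "1/2"]
    by (simp add: cbox_interval)
  moreover have "?g ((1/2) *\<^sub>R s + 1/2) = 2 powr (2 - 2*b) * ?w s" if "s \<in> {-1..1}" for s
  proof -
    have "?g ((1/2) *\<^sub>R s + 1/2) = ((1 - s\<^sup>2) / 4) powr (b - 1)"
      using that by (subst powr_mult[symmetric]) (auto simp: field_simps power2_eq_square)
    also have "\<dots> = ?w s * (4 powr (1 - b))"
      using that by (subst powr_divide) (auto simp: power_le_one_iff abs_square_le_1 powr_minus field_simps powr_diff)
    also have "(4::real) powr (1 - b) = 2 powr (2 - 2*b)"
      using powr_powr[of 2 2 "1 - b"] by (simp add: algebra_simps)
    finally show ?thesis by (simp add: mult.commute)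
  qed
  ultimately have "((\<lambda>s. 2 powr (2 - 2*b) * ?w s) has_integral 2 * Beta b b) {-1..1}"
    using has_integral_cong by (metis (no_types, lifting))
  from has_integral_mult_right[OF this, of "2 powr (2*b - 2)"]
  have full: "(?w has_integral 2 powr (2*b - 2) * (2 * Beta b b)) {-1..1}"
    by (simp add: mult.assoc[symmetric] powr_add[symmetric])
  then have "?w integrable_on {0..1}"
    using integrable_subinterval_real by (metis atLeastatMost_subset_iff has_integral_integrable order_refl neg_le_0_iff_le zero_le_one)
  then obtain I where I: "(?w has_integral I) {0..1}" by blast
  then have "(?w has_integral I) {-1..0}"
    by (subst has_integral_reflect_real[symmetric]) simp
  from has_integral_combine[OF _ _ this I] have "(?w has_integral I + I) {-1..1}" by simp
  from has_integral_unique[OF this full]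
  have "I = 2 powr (2*b - 2) * Beta b b" by simp
  then have "I = 2 powr (2 * b - 2) * (Gamma b)\<^sup>2 / Gamma (2 * b)"
    by (simp add: Beta_def power2_eq_square flip: mult_2)
  with I show ?thesis by simp
qed

lemma emeasure_weight_measure:
  assumes "b > 0"
  shows "emeasure (weight_measure b) {0<..<1}
           = ennreal (2 powr (2 * b - 2) * (Gamma b)\<^sup>2 / Gamma (2 * b))"
proof -
  have m: "(\<lambda>s. ennreal ((1 - s\<^sup>2) powr (b - 1))) \<in> borel_measurable (restrict_space lborel {0<..<1})"
    by measurable
  have "emeasure (weight_measure b) {0<..<1}
      = (\<integral>\<^sup>+s. ennreal ((1 - s\<^sup>2) powr (b - 1)) * indicator {0<..<1} s \<partial>restrict_space lborel {0<..<1})"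
    unfolding weight_measure_def using m by (rule emeasure_density) (auto simp: sets_restrict_space)
  also have "\<dots> = (\<integral>\<^sup>+s. ennreal ((1 - s\<^sup>2) powr (b - 1)) * indicator {0<..<1} s \<partial>lborel)"
    by (subst nn_integral_restrict_space) (auto intro!: nn_integral_cong simp: indicator_def)
  also have "\<dots> = ennreal (2 powr (2 * b - 2) * (Gamma b)\<^sup>2 / Gamma (2 * b))"
    using has_integral_weight[OF assms]
    by (intro nn_integral_has_integral_lebesgue') (auto simp: has_integral_Icc_iff_Ioo)
  finally show ?thesis .
qed

lemma finite_measure_weight_measure:
  assumes "b > 0" shows "finite_measure (weight_measure b)"
  by (rule finite_measureI) (simp add: emeasure_weight_measure[OF assms])

lemma measure_weight_measure:
  assumes "b > 0"
  shows "measure (weight_measure b) {0<..<1} = 2 powr (2 * b - 2) * (Gamma b)\<^sup>2 / Gamma (2 * b)"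
proof -
  have "0 \<le> 2 powr (2 * b - 2) * (Gamma b)\<^sup>2 / Gamma (2 * b)"
    using Gamma_real_pos[of "2*b"] assms by simp
  then show ?thesis by (simp add: measure_def emeasure_weight_measure[OF assms])
qed

lemma
  fixes f :: "real \<Rightarrow> complex"
  assumes f: "f \<in> borel_measurable (restrict_space borel {0<..<1})"
  shows integrable_weight_measure: "integrable (weight_measure b) f \<longleftrightarrow>
            set_integrable lborel {0<..<1} (\<lambda>s. (1 - s\<^sup>2) powr (b - 1) *\<^sub>R f s)"
    and integral_weight_measure:
      "(\<integral>s. f s \<partial>weight_measure b) = (LINT s:{0<..<1}|lborel. (1 - s\<^sup>2) powr (b - 1) *\<^sub>R f s)"
proof -
  have f': "f \<in> borel_measurable (restrict_space lborel {0<..<1})"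
    using f by (simp cong: measurable_cong_sets add: sets_restrict_space measurable_cong_sets[of "restrict_space lborel {0<..<1}" "restrict_space borel {0<..<1}"])
  show "integrable (weight_measure b) f \<longleftrightarrow>
            set_integrable lborel {0<..<1} (\<lambda>s. (1 - s\<^sup>2) powr (b - 1) *\<^sub>R f s)"
    unfolding weight_measure_def set_integrable_def
    by (subst integrable_density[OF f' weight_measurable]) (auto simp: integrable_restrict_space)
  show "(\<integral>s. f s \<partial>weight_measure b) = (LINT s:{0<..<1}|lborel. (1 - s\<^sup>2) powr (b - 1) *\<^sub>R f s)"
    unfolding weight_measure_def set_lebesgue_integral_def
    by (subst integral_density[OF f' weight_measurable]) (auto simp: integral_restrict_space)
qed

lemma LINT_Icc_eq_Ioo:
  fixes f :: "real \<Rightarrow> complex"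
  shows "(LINT s:{0..1}|lborel. f s) = (LINT s:{0<..<1}|lborel. f s)"
  unfolding set_lebesgue_integral_def
  by (rule integral_discrete_difference[where X = "{0, 1}"]) (auto simp: indicator_def)

text \<open>
  For \<open>b = \<gamma>\<close> and \<open>b = 1 - \<gamma>\<close> the factor on the left is the constant in front of the respective
  integral operator.
\<close>

lemma normalization_constant:
  assumes "b > 0"
  shows "2 powr (2 - 2 * b) * (Gamma (2 * b) / (Gamma b)\<^sup>2) * measure (weight_measure b) {0<..<1} = 1"
proof -
  have "Gamma b > 0" "Gamma (2 * b) > 0" using assms by (auto intro: Gamma_real_pos)
  then show ?thesis
    by (simp add: measure_weight_measure[OF assms] field_simps flip: powr_add)
qed

section \<open>Functions of class $C^k$ along given directions\<close>

lemma Ck_along_has_vector_derivative: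
  assumes "Ck_along E k U f" "e \<in> E" "set es \<subseteq> E" "length es < k" "p \<in> U"
  shows "((\<lambda>s. iter_deriv es f (p + s *\<^sub>R e)) has_vector_derivative iter_deriv (e # es) f p) (at 0)"
proof -
  have "(\<lambda>s. iter_deriv es f (p + s *\<^sub>R e)) differentiable (at 0)"
    using assms by (auto simp: Ck_along_def)
  then show ?thesis
    by (simp add: vector_derivative_works iter_deriv_def dir_deriv_def)
qed

lemma dir_deriv_cong_open:
  fixes f g :: "'a::real_normed_vector \<Rightarrow> 'b::real_normed_vector"
  assumes "open U" "p \<in> U" "\<And>q. q \<in> U \<Longrightarrow> g q = f q"
    and "((\<lambda>s. f (p + s *\<^sub>R e)) has_vector_derivative D) (at 0)"
  shows "((\<lambda>s. g (p + s *\<^sub>R e)) has_vector_derivative D) (at 0)"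
proof (rule has_vector_derivative_transform_within_open[OF assms(4)])
  show "open ((\<lambda>s::real. p + s *\<^sub>R e) -` U)"
    by (intro open_vimage assms(1) continuous_intros)
qed (use assms in auto)

text \<open>
  Iterated derivatives are awkward to compute with, because every stage is defined by a choice of
  limit. It suffices to exhibit candidates, indexed by the list of directions, each of which is
  differentiable with the next one as derivative.
\<close>

lemma Ck_along_family:
  assumes U: "open U" and f: "\<And>p. p \<in> U \<Longrightarrow> f p = F [] p"
    and cont: "\<And>es. set es \<subseteq> E \<Longrightarrow> length es \<le> k \<Longrightarrow> continuous_on U (F es)"
    and der: "\<And>e es p. e \<in> E \<Longrightarrow> set es \<subseteq> E \<Longrightarrow> length es < k \<Longrightarrow> p \<in> U \<Longrightarrow>
                ((\<lambda>s. F es (p + s *\<^sub>R e)) has_vector_derivative F (e # es) p) (at 0)"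
  shows Ck_along_family_iter_deriv:
      "\<And>es p. set es \<subseteq> E \<Longrightarrow> length es \<le> k \<Longrightarrow> p \<in> U \<Longrightarrow> iter_deriv es f p = F es p"
    and "Ck_along E k U f"
proof -
  have eq: "iter_deriv es f p = F es p"
    if "set es \<subseteq> E" "length es \<le> k" "p \<in> U" for es p
    using that
  proof (induction es arbitrary: p)
    case Nil
    then show ?case by (simp add: iter_deriv_def f)
  next
    case (Cons e es)
    have "((\<lambda>s. iter_deriv es f (p + s *\<^sub>R e)) has_vector_derivative F (e # es) p) (at 0)"
      using Cons by (intro dir_deriv_cong_open[OF U _ _ der]) auto
    then show ?case
      by (simp add: iter_deriv_def dir_deriv_def vector_derivative_at)
  qed
  show "Ck_along E k U f"
    unfolding Ck_along_def
  proof (intro conjI allI impI ballI)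
    fix es assume "set es \<subseteq> E \<and> length es \<le> k"
    then show "continuous_on U (iter_deriv es f)"
      using cont[of es] eq[of es] by (simp cong: continuous_on_cong)
  next
    fix e es p assume *: "e \<in> E \<and> set es \<subseteq> E \<and> length es < k" and "p \<in> U"
    then have "((\<lambda>s. iter_deriv es f (p + s *\<^sub>R e)) has_vector_derivative F (e # es) p) (at 0)"
      by (intro dir_deriv_cong_open[OF U _ _ der]) (auto simp: eq)
    then show "(\<lambda>s. iter_deriv es f (p + s *\<^sub>R e)) differentiable (at 0)"
      by (rule differentiableI_vector)
  qed
  show "\<And>es p. set es \<subseteq> E \<Longrightarrow> length es \<le> k \<Longrightarrow> p \<in> U \<Longrightarrow> iter_deriv es f p = F es p"
    by (rule eq)
qed

lemma Ck_along_add: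
  assumes U: "open U" and f: "Ck_along E k U f" and g: "Ck_along E k U g"
  shows iter_deriv_add: "\<And>es p. set es \<subseteq> E \<Longrightarrow> length es \<le> k \<Longrightarrow> p \<in> U \<Longrightarrow>
            iter_deriv es (\<lambda>p. f p + g p) p = iter_deriv es f p + iter_deriv es g p"
    and "Ck_along E k U (\<lambda>p. f p + g p)"
proof -
  let ?F = "\<lambda>es p. iter_deriv es f p + iter_deriv es g p"
  have 1: "f p + g p = ?F [] p" for p by (simp add: iter_deriv_def)
  have 2: "continuous_on U (?F es)" if "set es \<subseteq> E" "length es \<le> k" for es
    using that f g by (intro continuous_on_add) (auto simp: Ck_along_def)
  have 3: "((\<lambda>s. ?F es (p + s *\<^sub>R e)) has_vector_derivative ?F (e # es) p) (at 0)"
    if "e \<in> E" "set es \<subseteq> E" "length es < k" "p \<in> U" for e es p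
    using that by (intro has_vector_derivative_add Ck_along_has_vector_derivative[OF f]
        Ck_along_has_vector_derivative[OF g])
  show "\<And>es p. set es \<subseteq> E \<Longrightarrow> length es \<le> k \<Longrightarrow> p \<in> U \<Longrightarrow>
            iter_deriv es (\<lambda>p. f p + g p) p = iter_deriv es f p + iter_deriv es g p"
    by (rule Ck_along_family_iter_deriv[OF U 1 2 3])
  show "Ck_along E k U (\<lambda>p. f p + g p)"
    by (rule Ck_along_family[OF U 1 2 3])
qed

lemma length_index_list: "\<alpha> \<in> multi_indices m \<Longrightarrow> length (index_list \<alpha>) \<le> m"
  using sum_count_set[of "index_list \<alpha>" UNIV] count_index_list[of \<alpha>]
  by (simp add: multi_indices_def)

lemma Cm2_add:
  assumes "open U" "Cm2 m U f" "Cm2 m U g"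
  shows "Cm2 m U (\<lambda>p. f p + g p)"
  using assms Ck_along_add(2) unfolding Cm2_def by blast

lemma diff_op_add:
  assumes "open U" "Cm2 m U f" "Cm2 m U g" "p \<in> U"
  shows "diff_op m a (\<lambda>p. f p + g p) p = diff_op m a f p + diff_op m a g p"
proof -
  have "partial_x \<alpha> (\<lambda>p. f p + g p) p = partial_x \<alpha> f p + partial_x \<alpha> g p"
    if "\<alpha> \<in> multi_indices m" for \<alpha>
    unfolding partial_x_def
    by (rule iter_deriv_add[where E = "range x_dir" and k = m and U = U])
      (use assms length_index_list[OF that] in \<open>auto simp: Cm2_def\<close>)
  then show ?thesis
    by (simp add: diff_op_def algebra_simps flip: sum.distrib)
qed

section \<open>Averages along vertical segments\<close>

lemma powr_half_squared: "t > 0 \<Longrightarrow> (t powr (l / 2))\<^sup>2 = (t::real) powr l"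
  by (simp add: power2_eq_square flip: powr_add)

lemma powr_times_phi:
  assumes "l > 0" "t > 0"
  shows "t powr (l / 2) * phi l t = 2 / (l + 2) * (t * t powr l)"
    and "t powr (l / 2 - 1) * phi l t = 2 / (l + 2) * t powr l"
proof -
  have "t powr (l / 2) * t powr ((l + 2) / 2) = t powr (1 + l)"
    by (simp add: add_divide_distrib algebra_simps flip: powr_add)
  then show 1: "t powr (l / 2) * phi l t = 2 / (l + 2) * (t * t powr l)"
    using assms by (simp add: phi_def powr_add)
  have "t powr (l / 2 - 1) * t powr ((l + 2) / 2) = t powr l"
    by (simp add: add_divide_distrib algebra_simps flip: powr_add)
  then show "t powr (l / 2 - 1) * phi l t = 2 / (l + 2) * t powr l"
    by (simp add: phi_def)
qed

locale backward_domain =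
  fixes l :: real and \<Omega> :: "((real^'n) \<times> real) set"
  assumes l_pos: "l > 0" and upper: "\<Omega> \<subseteq> upper_half_space" and open_domain: "open \<Omega>"
    and backward: "backward_time_connected \<Omega>"
begin

abbreviation "\<Omega>\<^sub>\<phi> \<equiv> phi_image l \<Omega>"

text \<open>
  The class of functions for which averaging along segments down to time 0 is well behaved; the
  derivatives of a function in $C^{m,2}_{x,t}$ of the closure belong to it.
\<close>

definition extends_to_closure :: "((real^'n) \<times> real \<Rightarrow> complex) \<Rightarrow> bool" where
  "extends_to_closure f \<longleftrightarrow> (\<exists>g. continuous_on (closure \<Omega>\<^sub>\<phi>) g \<and> (\<forall>p\<in>\<Omega>\<^sub>\<phi>. g p = f p))"

definition ray :: "(real^'n) \<times> real \<Rightarrow> real \<Rightarrow> (real^'n) \<times> real" where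
  "ray p s = (fst p, phi l (snd p) * s)"

text \<open>
  Only \<open>k = 0\<close> occurs in the integral operators. The powers of \<open>s\<close> arise from differentiating
  \<open>v (x, phi l t * s)\<close> in \<open>t\<close>.
\<close>

definition avg :: "real \<Rightarrow> nat \<Rightarrow> ((real^'n) \<times> real \<Rightarrow> complex) \<Rightarrow> (real^'n) \<times> real \<Rightarrow> complex" where
  "avg b k f p = (\<integral>s. s ^ k *\<^sub>R f (ray p s) \<partial>weight_measure b)"

lemma time_pos: "p \<in> \<Omega> \<Longrightarrow> snd p > 0"
  using upper by (auto simp: upper_half_space_def)

lemma phi_pos: "t > 0 \<Longrightarrow> phi l t > 0"
  using l_pos by (simp add: phi_def)

lemma phi_deriv: "t > 0 \<Longrightarrow> (phi l has_real_derivative t powr (l / 2)) (at t)"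
proof -
  assume t: "t > 0"
  have e: "(l + 2) / 2 - 1 = l / 2" by (simp add: field_simps)
  have c: "2 / (l + 2) * ((l + 2) / 2) = 1" using l_pos by simp
  have "((\<lambda>t. 2 / (l + 2) * t powr ((l + 2) / 2)) has_real_derivative
      2 / (l + 2) * ((l + 2) / 2 * t powr ((l + 2) / 2 - 1))) (at t)"
    using t by (intro DERIV_cmult has_real_derivative_powr)
  then show ?thesis
    unfolding e mult.assoc[symmetric] c by (simp add: phi_def[abs_def])
qed

lemma continuous_on_ray_map:
  "K \<subseteq> \<Omega> \<Longrightarrow> continuous_on (K \<times> S) (\<lambda>(p, s). ray p s)"
  unfolding ray_def phi_def case_prod_unfold
  by (intro continuous_intros) (auto dest!: time_pos subsetD)

lemma ray_mem: "p \<in> \<Omega> \<Longrightarrow> 0 < s \<Longrightarrow> s \<le> 1 \<Longrightarrow> ray p s \<in> \<Omega>\<^sub>\<phi>"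
  using phi_pos[of "snd p"] time_pos[of p]
  by (auto simp: ray_def phi_image_def mult_left_le intro!: bexI[of _ p])

lemma extends_to_closure_continuous_on: "extends_to_closure f \<Longrightarrow> continuous_on \<Omega>\<^sub>\<phi> f"
  unfolding extends_to_closure_def by (metis closure_subset continuous_on_cong continuous_on_subset)

text \<open>
  The segments below a compact set of points, including their end points at time 0, form a compact
  subset of the closure of \<open>\<Omega>\<^sub>\<phi>\<close>, on which the extension of \<open>f\<close> is bounded.
\<close>

lemma bounded_along_rays:
  assumes f: "extends_to_closure f" and K: "compact K" "K \<subseteq> \<Omega>"
  obtains B where "\<And>p s. p \<in> K \<Longrightarrow> 0 < s \<Longrightarrow> s < 1 \<Longrightarrow> norm (f (ray p s)) \<le> B"
proof -
  obtain g where g: "continuous_on (closure \<Omega>\<^sub>\<phi>) g" "\<And>p. p \<in> \<Omega>\<^sub>\<phi> \<Longrightarrow> g p = f p"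
    using f by (auto simp: extends_to_closure_def)
  let ?h = "\<lambda>(p, s). ray p s"
  have cl: "closure (K \<times> {0<..1}) = K \<times> {0..1::real}"
    using K by (simp add: closure_Times compact_imp_closed)
  have h: "continuous_on (K \<times> {0..1}) ?h" by (rule continuous_on_ray_map[OF K(2)])
  have "?h ` closure (K \<times> {0<..1}) \<subseteq> closure \<Omega>\<^sub>\<phi>"
  proof (rule image_closure_subset)
    show "?h ` (K \<times> {0<..1}) \<subseteq> closure \<Omega>\<^sub>\<phi>"
      using ray_mem K(2) closure_subset by fastforce
  qed (use h cl in auto)
  then have sub: "?h ` (K \<times> {0..1}) \<subseteq> closure \<Omega>\<^sub>\<phi>" unfolding cl .
  have "compact (g ` ?h ` (K \<times> {0..1}))"
    using K h g(1) sub
    by (intro compact_continuous_image compact_Times) (auto intro: continuous_on_subset)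
  then obtain B where B: "\<And>z. z \<in> g ` ?h ` (K \<times> {0..1}) \<Longrightarrow> norm z \<le> B"
    by (meson compact_imp_bounded bounded_iff)
  show thesis
  proof (rule that[of B])
    fix p and s :: real assume ps: "p \<in> K" "0 < s" "s < 1"
    then have "f (ray p s) = g (?h (p, s))"
      using g(2)[OF ray_mem[of p s]] K by auto
    also have "norm \<dots> \<le> B" using ps by (intro B imageI) auto
    finally show "norm (f (ray p s)) \<le> B" .
  qed
qed

lemma continuous_along_ray:
  assumes "extends_to_closure f" "p \<in> \<Omega>" shows "continuous_on {0<..1} (\<lambda>s. f (ray p s))"
proof -
  have "continuous_on {0<..1} (f \<circ> ray p)"
  proof (rule continuous_on_compose)
    show "continuous_on {0<..1} (ray p)"
      unfolding ray_def by (intro continuous_intros)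
    show "continuous_on (ray p ` {0<..1}) f"
      by (rule continuous_on_subset[OF extends_to_closure_continuous_on[OF assms(1)]]) (use assms(2) in \<open>auto intro: ray_mem\<close>)
  qed
  then show ?thesis by (simp add: comp_def)
qed

lemma measurable_avg:
  assumes "extends_to_closure f" "p \<in> \<Omega>"
  shows "(\<lambda>s. s ^ k *\<^sub>R f (ray p s)) \<in> borel_measurable (weight_measure b)"
  unfolding measurable_weight_measure
  by (intro borel_measurable_continuous_on_restrict continuous_intros
      continuous_on_subset[OF continuous_along_ray[OF assms]]) auto

lemma norm_power_scaleR_le:
  fixes z :: complex and s :: real
  assumes "0 < s" "s < 1" "norm z \<le> B"
  shows "norm (s ^ k *\<^sub>R z) \<le> B"
proof -
  have "norm (s ^ k *\<^sub>R z) \<le> 1 * norm z"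
    using assms by (simp add: power_le_one mult_right_le_one_le mult.commute)
  with assms(3) show ?thesis by simp
qed

lemma integrable_avg:
  assumes "b > 0" "extends_to_closure f" "p \<in> \<Omega>"
  shows "integrable (weight_measure b) (\<lambda>s. s ^ k *\<^sub>R f (ray p s))"
proof -
  interpret finite_measure "weight_measure b" by (rule finite_measure_weight_measure[OF assms(1)])
  obtain B where B: "\<And>s. 0 < s \<Longrightarrow> s < 1 \<Longrightarrow> norm (f (ray p s)) \<le> B"
    using bounded_along_rays[OF assms(2), of "{p}"] assms(3)
    by (metis compact_sing empty_subsetI insert_subset singletonI)
  show ?thesis
  proof (rule integrable_const_bound[of _ B])
    show "AE s in weight_measure b. norm (s ^ k *\<^sub>R f (ray p s)) \<le> B"
      using B by (intro AE_I2 norm_power_scaleR_le) auto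
  qed (rule measurable_avg[OF assms(2,3)])
qed

text \<open>
  A convergent sequence together with its limit is compact, so \<open>f\<close> has a common bound along all the
  segments involved and dominated convergence applies.
\<close>

lemma continuous_on_avg:
  assumes b: "b > 0" and f: "extends_to_closure f"
  shows "continuous_on \<Omega> (avg b k f)"
  unfolding continuous_on_sequentially comp_def
proof (intro allI ballI impI, elim conjE)
  fix X p assume p: "p \<in> \<Omega>" and X: "\<forall>i. X i \<in> \<Omega>" "X \<longlonglongrightarrow> p"
  interpret finite_measure "weight_measure b" by (rule finite_measure_weight_measure[OF b])
  obtain B where B: "\<And>q s. q \<in> insert p (range X) \<Longrightarrow> 0 < s \<Longrightarrow> s < 1 \<Longrightarrow> norm (f (ray q s)) \<le> B"
    using bounded_along_rays[OF f compact_sequence_with_limit[OF X(2)]] p X(1) by blast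
  show "(\<lambda>i. avg b k f (X i)) \<longlonglongrightarrow> avg b k f p"
    unfolding avg_def
  proof (rule integral_dominated_convergence[where w = "\<lambda>_. B"])
    show "AE s in weight_measure b. (\<lambda>i. s ^ k *\<^sub>R f (ray (X i) s)) \<longlonglongrightarrow> s ^ k *\<^sub>R f (ray p s)"
    proof (rule AE_I2)
      fix s assume "s \<in> space (weight_measure b)"
      then have s: "0 < s" "s < 1" by auto
      have "(\<lambda>i. ray (X i) s) \<longlonglongrightarrow> ray p s"
        unfolding ray_def phi_def using X(2) time_pos[OF p] by (intro tendsto_intros) auto
      then have "(\<lambda>i. f (ray (X i) s)) \<longlonglongrightarrow> f (ray p s)"
        using extends_to_closure_continuous_on[OF f] s X(1) p
        by (auto intro!: continuous_on_tendsto_compose[where s = "\<Omega>\<^sub>\<phi>"] always_eventually ray_mem)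
      then show "(\<lambda>i. s ^ k *\<^sub>R f (ray (X i) s)) \<longlonglongrightarrow> s ^ k *\<^sub>R f (ray p s)"
        by (intro tendsto_intros)
    qed
    show "AE s in weight_measure b. norm (s ^ k *\<^sub>R f (ray (X i) s)) \<le> B" for i
      using B by (intro AE_I2 norm_power_scaleR_le) auto
  qed (use measurable_avg[OF f] p X(1) in auto)
qed

lemma segment_in_domain:
  assumes "p \<in> \<Omega>"
  obtains \<delta> where "\<delta> > 0" "(\<lambda>r::real. p + r *\<^sub>R e) ` cball 0 \<delta> \<subseteq> \<Omega>"
proof -
  have "open ((\<lambda>r::real. p + r *\<^sub>R e) -` \<Omega>)"
    by (intro open_vimage open_domain continuous_intros)
  then obtain \<delta> where "\<delta> > 0" "cball 0 \<delta> \<subseteq> (\<lambda>r::real. p + r *\<^sub>R e) -` \<Omega>"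
    using assms by (force simp: open_contains_cball)
  then show thesis by (intro that) auto
qed

text \<open>
  A horizontal translation of \<open>p\<close> translates its whole segment by the same vector.
\<close>

lemma avg_x_deriv:
  assumes b: "b > 0" and f: "extends_to_closure f" and f': "extends_to_closure f'"
    and der: "\<And>q. q \<in> \<Omega>\<^sub>\<phi> \<Longrightarrow> ((\<lambda>r. f (q + r *\<^sub>R e)) has_vector_derivative f' q) (at 0)"
    and p: "p \<in> \<Omega>" and e: "snd e = 0"
  shows "((\<lambda>r. avg b k f (p + r *\<^sub>R e)) has_vector_derivative avg b k f' p) (at 0)"
proof -
  obtain \<delta> where \<delta>: "\<delta> > 0" "(\<lambda>r::real. p + r *\<^sub>R e) ` cball 0 \<delta> \<subseteq> \<Omega>" (is "?K \<subseteq> _")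
    using segment_in_domain[OF p] by blast
  have "compact ?K" by (intro compact_continuous_image continuous_intros compact_cball)
  then obtain B where B: "\<And>q s. q \<in> ?K \<Longrightarrow> 0 < s \<Longrightarrow> s < 1 \<Longrightarrow> norm (f' (ray q s)) \<le> B"
    using bounded_along_rays[OF f' _ \<delta>(2)] by blast
  have mem: "p + r *\<^sub>R e \<in> ?K" if "r \<in> ball 0 \<delta>" for r using that by auto
  then have mem': "p + r *\<^sub>R e \<in> \<Omega>" if "r \<in> ball 0 \<delta>" for r using that \<delta>(2) by blast
  have "((\<lambda>r. \<integral>s. s ^ k *\<^sub>R f (ray (p + r *\<^sub>R e) s) \<partial>weight_measure b) has_vector_derivative
          (\<integral>s. s ^ k *\<^sub>R f' (ray (p + 0 *\<^sub>R e) s) \<partial>weight_measure b)) (at 0)"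
  proof (rule has_vector_derivative_integral_param[OF finite_measure_weight_measure[OF b] \<delta>(1),
        where F' = "\<lambda>r s. s ^ k *\<^sub>R f' (ray (p + r *\<^sub>R e) s)" and B = B])
    fix r s :: real assume r: "r \<in> ball 0 \<delta>" and "s \<in> space (weight_measure b)"
    then have s: "0 < s" "s < 1" by auto
    let ?q = "ray (p + r *\<^sub>R e) s"
    have "?q \<in> \<Omega>\<^sub>\<phi>" using mem'[OF r] s by (intro ray_mem) auto
    moreover have "((\<lambda>r'. r' - r) has_vector_derivative 1) (at r)"
      by (auto intro!: derivative_eq_intros)
    ultimately have "((\<lambda>h. f (?q + h *\<^sub>R e)) \<circ> (\<lambda>r'. r' - r) has_vector_derivative 1 *\<^sub>R f' ?q) (at r)"
      using der by (intro vector_diff_chain_at) auto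
    moreover have "?q + (r' - r) *\<^sub>R e = ray (p + r' *\<^sub>R e) s" for r'
      using e by (simp add: ray_def prod_eq_iff algebra_simps)
    ultimately have "((\<lambda>r. f (ray (p + r *\<^sub>R e) s)) has_vector_derivative f' ?q) (at r)"
      by (simp add: comp_def)
    then show "((\<lambda>r. s ^ k *\<^sub>R f (ray (p + r *\<^sub>R e) s)) has_vector_derivative s ^ k *\<^sub>R f' ?q) (at r)"
      by (rule bounded_linear.has_vector_derivative[OF bounded_linear_scaleR_right])
    show "norm (s ^ k *\<^sub>R f' ?q) \<le> B"
      using B mem[OF r] s by (intro norm_power_scaleR_le)
  qed (use integrable_avg[OF b] f f' mem' p in auto)
  then show ?thesis by (simp add: avg_def)
qed

text \<open>
  Moving \<open>p\<close> upwards with speed 1 moves the point with parameter \<open>s\<close> upwards with speed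
  $\phi'(t) s$; this is the source of both the factor \<open>t powr (l / 2)\<close> and the additional power of
  \<open>s\<close>.
\<close>

lemma avg_t_deriv:
  assumes b: "b > 0" and f: "extends_to_closure f" and f': "extends_to_closure f'"
    and der: "\<And>q. q \<in> \<Omega>\<^sub>\<phi> \<Longrightarrow> ((\<lambda>r. f (q + r *\<^sub>R t_dir)) has_vector_derivative f' q) (at 0)"
    and p: "p \<in> \<Omega>"
  shows "((\<lambda>r. avg b k f (p + r *\<^sub>R t_dir)) has_vector_derivative
            (snd p powr (l / 2)) *\<^sub>R avg b (Suc k) f' p) (at 0)"
proof -
  let ?e = "t_dir :: (real^'n) \<times> real"
  obtain \<delta> where \<delta>: "\<delta> > 0" "(\<lambda>r::real. p + r *\<^sub>R ?e) ` cball 0 \<delta> \<subseteq> \<Omega>" (is "?K \<subseteq> _")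
    using segment_in_domain[OF p] by blast
  have "compact ?K" by (intro compact_continuous_image continuous_intros compact_cball)
  then obtain B where B: "\<And>q s. q \<in> ?K \<Longrightarrow> 0 < s \<Longrightarrow> s < 1 \<Longrightarrow> norm (f' (ray q s)) \<le> B"
    using bounded_along_rays[OF f' _ \<delta>(2)] by blast
  have mem: "p + r *\<^sub>R ?e \<in> ?K" if "r \<in> ball 0 \<delta>" for r using that by auto
  then have mem': "p + r *\<^sub>R ?e \<in> \<Omega>" if "r \<in> ball 0 \<delta>" for r using that \<delta>(2) by blast
  have "((\<lambda>r. \<integral>s. s ^ k *\<^sub>R f (ray (p + r *\<^sub>R ?e) s) \<partial>weight_measure b) has_vector_derivative
          (\<integral>s. (snd p + 0) powr (l / 2) *\<^sub>R s ^ Suc k *\<^sub>R f' (ray (p + 0 *\<^sub>R ?e) s) \<partial>weight_measure b)) (at 0)"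
  proof (rule has_vector_derivative_integral_param[OF finite_measure_weight_measure[OF b] \<delta>(1),
        where F' = "\<lambda>r s. (snd p + r) powr (l / 2) *\<^sub>R s ^ Suc k *\<^sub>R f' (ray (p + r *\<^sub>R ?e) s)"
          and B = "(snd p + \<delta>) powr (l / 2) * B"])
    fix r s :: real assume r: "r \<in> ball 0 \<delta>" and "s \<in> space (weight_measure b)"
    then have s: "0 < s" "s < 1" by auto
    let ?q = "ray (p + r *\<^sub>R ?e) s"
    let ?h = "\<lambda>r'. phi l (snd p + r') * s - phi l (snd p + r) * s"
    have pos: "snd p + r > 0" using time_pos[OF mem'[OF r]] by (simp add: t_dir_def)
    have "(?h has_real_derivative (snd p + r) powr (l / 2) * s) (at r)"
      using DERIV_shift[THEN iffD1, of "phi l" _ r "snd p"] phi_deriv[OF pos]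
      by (auto intro!: derivative_eq_intros simp: add.commute)
    then have h: "(?h has_vector_derivative (snd p + r) powr (l / 2) * s) (at r)"
      by (simp add: has_real_derivative_iff_has_vector_derivative)
    have "?q \<in> \<Omega>\<^sub>\<phi>" using mem'[OF r] s by (intro ray_mem) auto
    then have "((\<lambda>h. f (?q + h *\<^sub>R ?e)) \<circ> ?h has_vector_derivative ((snd p + r) powr (l / 2) * s) *\<^sub>R f' ?q) (at r)"
      using h der by (intro vector_diff_chain_at) auto
    moreover have "?q + ?h r' *\<^sub>R ?e = ray (p + r' *\<^sub>R ?e) s" for r'
      by (simp add: ray_def prod_eq_iff t_dir_def)
    ultimately have "((\<lambda>r. f (ray (p + r *\<^sub>R ?e) s)) has_vector_derivative
        ((snd p + r) powr (l / 2) * s) *\<^sub>R f' ?q) (at r)"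
      by (simp add: comp_def)
    from bounded_linear.has_vector_derivative[OF bounded_linear_scaleR_right this, of "s ^ k"]
    show "((\<lambda>r. s ^ k *\<^sub>R f (ray (p + r *\<^sub>R ?e) s)) has_vector_derivative
        (snd p + r) powr (l / 2) *\<^sub>R s ^ Suc k *\<^sub>R f' ?q) (at r)"
      by (simp add: mult_ac)
    have "norm (s ^ Suc k *\<^sub>R f' ?q) \<le> B"
      using B mem[OF r] s by (intro norm_power_scaleR_le)
    moreover have "(snd p + r) powr (l / 2) \<le> (snd p + \<delta>) powr (l / 2)"
      using pos r l_pos by (intro powr_mono2) auto
    ultimately have "(snd p + r) powr (l / 2) * norm (s ^ Suc k *\<^sub>R f' ?q) \<le> (snd p + \<delta>) powr (l / 2) * B"
      by (intro mult_mono) auto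
    then show "norm ((snd p + r) powr (l / 2) *\<^sub>R s ^ Suc k *\<^sub>R f' ?q) \<le> (snd p + \<delta>) powr (l / 2) * B"
      by (subst norm_scaleR) simp
  next
    show "integrable (weight_measure b) (\<lambda>s. s ^ k *\<^sub>R f (ray (p + r *\<^sub>R ?e) s))"
      if "r \<in> ball 0 \<delta>" for r
      by (rule integrable_avg[OF b f mem'[OF that]])
    show "integrable (weight_measure b)
        (\<lambda>s. (snd p + 0) powr (l / 2) *\<^sub>R s ^ Suc k *\<^sub>R f' (ray (p + 0 *\<^sub>R ?e) s))"
      using integrable_avg[OF b f' p] by (intro integrable_scaleR_right) (simp del: power_Suc)
  qed
  then show ?thesis by (simp add: avg_def del: power_Suc scaleR_scaleR)
qed

lemma ray_tendsto_bottom: "p \<in> \<Omega> \<Longrightarrow> filterlim (ray p) (at (fst p, 0) within \<Omega>\<^sub>\<phi>) (at_right 0)"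
  unfolding filterlim_at
proof
  assume p: "p \<in> \<Omega>"
  have "eventually (\<lambda>s::real. s \<in> {0<..<1}) (at_right 0)"
    by (rule eventually_at_right_real) simp
  then show "eventually (\<lambda>s. ray p s \<in> \<Omega>\<^sub>\<phi> \<and> ray p s \<noteq> (fst p, 0)) (at_right 0)"
  proof eventually_elim
    case (elim s)
    then show ?case
      using ray_mem[OF p, of s] phi_pos[OF time_pos[OF p]] by (auto simp: ray_def)
  qed
  show "(ray p \<longlongrightarrow> (fst p, 0)) (at_right 0)"
    unfolding ray_def by (auto intro!: tendsto_eq_intros)
qed

text \<open>
  With $h(s) = f(x, \tau s)$, the derivative of $-(1-s^2)^b h(s)$ is
  $(1-s^2)^{b-1} (2 b s\, h(s) - (1-s^2)\, h'(s))$. Its integral is zero: the boundary term at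
  \<open>s = 1\<close> vanishes since \<open>b > 0\<close>, the one at \<open>s = 0\<close> by the limit assumption on \<open>f\<close>.
  The lemma is meant for $f = \partial_t v$.
\<close>

lemma avg_by_parts:
  assumes b: "b > 0" and f: "extends_to_closure f" and f': "extends_to_closure f'"
    and der: "\<And>q. q \<in> \<Omega>\<^sub>\<phi> \<Longrightarrow> ((\<lambda>r. f (q + r *\<^sub>R t_dir)) has_vector_derivative f' q) (at 0)"
    and p: "p \<in> \<Omega>" and lim: "(f \<longlongrightarrow> 0) (at (fst p, 0) within \<Omega>\<^sub>\<phi>)"
  shows "(2 * b) *\<^sub>R avg b 1 f p = phi l (snd p) *\<^sub>R (avg b 0 f' p - avg b 2 f' p)"
proof -
  define \<tau> where "\<tau> = phi l (snd p)"
  define h where "h s = f (ray p s)" for s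
  define h' where "h' s = f' (ray p s)" for s
  define g where "g s = (2 * b) *\<^sub>R s ^ 1 *\<^sub>R h s - \<tau> *\<^sub>R (s ^ 0 *\<^sub>R h' s - s ^ 2 *\<^sub>R h' s)" for s
  define H where "H s = - ((1 - s\<^sup>2) powr b *\<^sub>R h s)" for s
  let ?w = "\<lambda>s. (1 - s\<^sup>2) powr (b - 1)"
  have w: "1 - s\<^sup>2 > 0" if "0 < s" "s < 1" for s :: real
    using that by (simp add: power_less_one_iff abs_square_less_1)
  note int = integrable_avg[OF b f p, folded h_def] integrable_avg[OF b f' p, folded h'_def]
  have cont: "continuous_on {0<..<1} h" "continuous_on {0<..<1} h'"
    unfolding h_def h'_def
    by (rule continuous_on_subset[OF continuous_along_ray[OF _ p]]; use f f' in auto)+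
  have contg: "continuous_on {0<..<1} g"
    unfolding g_def by (intro continuous_intros cont)
  have H': "(H has_vector_derivative ?w s *\<^sub>R g s) (at s)" if s: "0 < s" "s < 1" for s
  proof -
    have "((\<lambda>r. f (ray p s + r *\<^sub>R t_dir)) \<circ> (\<lambda>s'. \<tau> * s' - \<tau> * s) has_vector_derivative \<tau> *\<^sub>R h' s) (at s)"
    proof (rule vector_diff_chain_at)
      show "((\<lambda>s'. \<tau> * s' - \<tau> * s) has_vector_derivative \<tau>) (at s)"
        unfolding has_real_derivative_iff_has_vector_derivative[symmetric]
        by (auto intro!: derivative_eq_intros)
      show "((\<lambda>r. f (ray p s + r *\<^sub>R t_dir)) has_vector_derivative h' s) (at (\<tau> * s - \<tau> * s))"
        using der[OF ray_mem[OF p s(1)]] s by (simp add: h'_def)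
    qed
    moreover have "ray p s + (\<tau> * s' - \<tau> * s) *\<^sub>R t_dir = ray p s'" for s'
      by (simp add: ray_def \<tau>_def t_dir_def)
    ultimately have dh: "(h has_vector_derivative \<tau> *\<^sub>R h' s) (at s)"
      by (simp add: comp_def h_def[abs_def])
    have dw: "((\<lambda>s. (1 - s\<^sup>2) powr b) has_real_derivative - (2 * b * s * ?w s)) (at s)"
      using w[OF s] by (auto intro!: derivative_eq_intros simp: powr_diff)
    have "?w s * (1 - s\<^sup>2) = (1 - s\<^sup>2) powr b"
      using w[OF s] by (simp add: powr_diff)
    then have "- ((1 - s\<^sup>2) powr b *\<^sub>R (\<tau> *\<^sub>R h' s) + (- (2 * b * s * ?w s)) *\<^sub>R h s)
        = ?w s *\<^sub>R g s"
      by (simp add: g_def algebra_simps flip: \<open>?w s * (1 - s\<^sup>2) = (1 - s\<^sup>2) powr b\<close>)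
    then show ?thesis
      using has_vector_derivative_minus[OF has_vector_derivative_scaleR[OF dw dh]]
      unfolding H_def by simp
  qed
  have gm: "g \<in> borel_measurable (restrict_space borel {0<..<1})"
    by (rule borel_measurable_continuous_on_restrict[OF contg])
  have gi: "integrable (weight_measure b) g"
    unfolding g_def
    by (intro Bochner_Integration.integrable_diff integrable_scaleR_right int)
  have "(LBINT s=0..1. ?w s *\<^sub>R g s) = 0 - 0"
  proof (rule interval_integral_FTC_integrable)
    show "(H has_vector_derivative ?w s *\<^sub>R g s) (at s)" if "0 < ereal s" "ereal s < 1" for s
      using that by (intro H') (auto simp: zero_ereal_def one_ereal_def)
    show "isCont (\<lambda>s. ?w s *\<^sub>R g s) s" if "0 < ereal s" "ereal s < 1" for s
    proof -
      from that have s: "s \<in> {0<..<1}" by (auto simp: zero_ereal_def one_ereal_def)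
      then have "isCont g s" using contg continuous_on_interior by fastforce
      then show ?thesis using w[of s] s by (intro continuous_intros) auto
    qed
    show "set_integrable lborel (einterval 0 1) (\<lambda>s. ?w s *\<^sub>R g s)"
      using integrable_weight_measure[OF gm] gi by (simp add: zero_ereal_def one_ereal_def)
    have h0: "(h \<longlongrightarrow> 0) (at_right 0)"
      unfolding h_def by (rule filterlim_compose[OF lim ray_tendsto_bottom[OF p]])
    have "((\<lambda>s::real. (1 - s\<^sup>2) powr b) \<longlongrightarrow> 1) (at_right 0)"
      by (auto intro!: tendsto_eq_intros)
    from tendsto_minus[OF tendsto_scaleR[OF this h0]] have "(H \<longlongrightarrow> 0) (at_right 0)"
      by (simp add: H_def[abs_def])
    then show "((H \<circ> real_of_ereal) \<longlongrightarrow> 0) (at_right 0)"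
      by (simp add: zero_ereal_def ereal_tendsto_simps)
    have h1: "(h \<longlongrightarrow> h 1) (at_left 1)"
    proof -
      have "continuous_on {0<..1} h" unfolding h_def by (rule continuous_along_ray[OF f p])
      then have "continuous_on {1/2..1} h" by (rule continuous_on_subset) auto
      then have "(h \<longlongrightarrow> h 1) (at 1 within {1/2..1})" by (simp add: continuous_on_def)
      then show ?thesis by (simp add: at_within_Icc_at_left)
    qed
    have "eventually (\<lambda>s::real. s \<in> {0<..<1}) (at_left 1)"
      by (rule eventually_at_left_real) simp
    then have "eventually (\<lambda>s::real. 0 \<le> 1 - s\<^sup>2) (at_left 1)"
      by eventually_elim (use w in \<open>auto intro: less_imp_le\<close>)
    then have "((\<lambda>s::real. (1 - s\<^sup>2) powr b) \<longlongrightarrow> (1 - 1\<^sup>2) powr b) (at_left 1)"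
      using b by (intro tendsto_powr' tendsto_intros) auto
    from tendsto_minus[OF tendsto_scaleR[OF this h1]] have "(H \<longlongrightarrow> 0) (at_left 1)"
      by (simp add: H_def[abs_def])
    then show "((H \<circ> real_of_ereal) \<longlongrightarrow> 0) (at_left 1)"
      by (simp add: one_ereal_def ereal_tendsto_simps)
  qed simp
  then have "(\<integral>s. g s \<partial>weight_measure b) = 0"
    by (simp add: integral_weight_measure[OF gm] interval_lebesgue_integral_def zero_ereal_def one_ereal_def)
  moreover have "(\<integral>s. g s \<partial>weight_measure b) =
      (2 * b) *\<^sub>R avg b 1 f p - \<tau> *\<^sub>R (avg b 0 f' p - avg b 2 f' p)"
  proof -
    have lin: "(\<integral>s. c *\<^sub>R F s - d *\<^sub>R (G s - K s) \<partial>M) = c *\<^sub>R integral\<^sup>L M F - d *\<^sub>R (integral\<^sup>L M G - integral\<^sup>L M K)"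
      if "integrable M F" "integrable M G" "integrable M K"
      for M and F G K :: "real \<Rightarrow> complex" and c d :: real
      using that by simp
    show ?thesis
      unfolding g_def avg_def h_def[symmetric] h'_def[symmetric] by (intro lin int)
  qed
  ultimately show ?thesis by (simp add: \<tau>_def)
qed

lemma time_powr_tendsto_bottom:
  assumes "c > 0"
  shows "((\<lambda>p. snd p powr c) \<longlongrightarrow> 0) (at (x, 0) within \<Omega>)"
proof -
  have "eventually (\<lambda>p. p \<in> \<Omega>) (at (x, 0) within \<Omega>)"
    by (simp add: eventually_at_filter)
  then have "eventually (\<lambda>p. 0 \<le> snd p) (at (x, 0) within \<Omega>)"
    by eventually_elim (use time_pos in \<open>auto intro: less_imp_le\<close>)
  moreover have "(snd \<longlongrightarrow> (0::real)) (at (x, 0) within \<Omega>)"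
    by (auto intro!: tendsto_eq_intros)
  ultimately have "((\<lambda>p. snd p powr c) \<longlongrightarrow> 0 powr c) (at (x, 0) within \<Omega>)"
    using assms by (intro tendsto_powr' tendsto_const) auto
  then show ?thesis by simp
qed

text \<open>
  As \<open>p\<close> approaches \<open>(x, 0)\<close>, its entire segment does so, because no point of the segment is
  farther from \<open>(x, 0)\<close> than its top \<open>ray p 1\<close>. Hence \<open>f\<close> is uniformly close to \<open>c\<close> along it.
\<close>

lemma avg_tendsto_bottom:
  assumes b: "b > 0" and f: "extends_to_closure f" and lim: "(f \<longlongrightarrow> c) (at (x, 0) within \<Omega>\<^sub>\<phi>)"
  shows "(avg b k f \<longlongrightarrow> (\<integral>s. s ^ k \<partial>weight_measure b) *\<^sub>R c) (at (x, 0) within \<Omega>)"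
proof (rule tendstoI)
  fix \<epsilon> :: real assume \<epsilon>: "\<epsilon> > 0"
  interpret finite_measure "weight_measure b" by (rule finite_measure_weight_measure[OF b])
  define m where "m = measure (weight_measure b) {0<..<1}"
  \<comment> \<open>the denominator \<open>m + 1\<close> avoids a case distinction on whether the mass is zero\<close>
  define \<eta> where "\<eta> = \<epsilon> / (m + 1)"
  have m: "m \<ge> 0" by (simp add: m_def)
  then have \<eta>: "\<eta> > 0" using \<epsilon> by (simp add: \<eta>_def)
  have "\<eta> * m < \<epsilon>" using \<epsilon> m by (simp add: \<eta>_def field_simps)
  obtain d where d: "d > 0" and
    near: "\<And>q. q \<in> \<Omega>\<^sub>\<phi> \<Longrightarrow> q \<noteq> (x, 0) \<Longrightarrow> dist q (x, 0) < d \<Longrightarrow> dist (f q) c < \<eta>"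
    using tendstoD[OF lim \<eta>] unfolding eventually_at by blast
  have ev: "eventually (\<lambda>p. p \<in> \<Omega>) (at (x, 0) within \<Omega>)"
    by (simp add: eventually_at_filter)
  have "((\<lambda>p. phi l (snd p)) \<longlongrightarrow> 2 / (l + 2) * 0) (at (x, 0) within \<Omega>)"
    unfolding phi_def using l_pos by (intro tendsto_mult tendsto_const time_powr_tendsto_bottom) auto
  then have "((\<lambda>p. ray p 1) \<longlongrightarrow> (x, 0)) (at (x, 0) within \<Omega>)"
    unfolding ray_def by (auto intro!: tendsto_eq_intros)
  from tendstoD[OF this d] ev
  show "eventually (\<lambda>p. dist (avg b k f p) ((\<integral>s. s ^ k \<partial>weight_measure b) *\<^sub>R c) < \<epsilon>)
      (at (x, 0) within \<Omega>)"
  proof eventually_elim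
    case (elim p)
    have close: "norm (s ^ k *\<^sub>R (f (ray p s) - c)) \<le> \<eta>" if s: "0 < s" "s < 1" for s
    proof (rule norm_power_scaleR_le[OF s])
      have "dist (ray p s) (x, 0) \<le> dist (ray p 1) (x, 0)"
        using s by (auto simp: ray_def dist_Pair_Pair abs_mult power_mult_distrib
            mult_right_le_one_le power_le_one)
      moreover have "ray p s \<noteq> (x, 0)"
        using s phi_pos[OF time_pos[OF elim(2)]] by (simp add: ray_def)
      ultimately show "norm (f (ray p s) - c) \<le> \<eta>"
        using near[of "ray p s"] ray_mem[OF elim(2), of s] s elim(1)
        by (simp add: dist_norm)
    qed
    have ik: "integrable (weight_measure b) (\<lambda>s. s ^ k)"
      by (rule integrable_const_bound[of _ 1])
        (auto intro!: AE_I2 power_le_one borel_measurable_continuous_on_restrict continuous_intros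
          simp: measurable_weight_measure power_abs)
    have "avg b k f p - (\<integral>s. s ^ k \<partial>weight_measure b) *\<^sub>R c
        = (\<integral>s. s ^ k *\<^sub>R f (ray p s) - s ^ k *\<^sub>R c \<partial>weight_measure b)"
      using integrable_avg[OF b f elim(2)] ik by (simp add: avg_def)
    also have "norm \<dots> \<le> (\<integral>s. \<eta> \<partial>weight_measure b)"
      by (rule Bochner_Integration.integral_norm_bound_integral)
        (use close ik integrable_avg[OF b f elim(2)] in \<open>auto simp: scaleR_right_diff_distrib\<close>)
    also have "\<dots> = \<eta> * m" by (simp add: m_def)
    finally show ?case using \<open>\<eta> * m < \<epsilon>\<close> by (simp add: dist_norm)
  qed
qed

section \<open>The transformed equation\<close>

text \<open>
  The assumption \<open>EPD\<close> is what remains of the equation for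
  $w = (\alpha + \beta t) I_0 v$ after both time derivatives have been taken. The left-hand factor of
  \<open>phi l t\<close> is the coefficient of $I_1 v_t$ in $\partial_t^2 w$, and $(\alpha+\beta t) t^\ell$ that of
  $I_2 v_{tt}$. Integration by parts replaces the first of these terms by
  a multiple of $(I_0 - I_2) v_{tt}$, and the assumption identifies the factor as
  $(\alpha+\beta t) t^\ell$, so that the $I_2$ terms cancel.
\<close>

lemma weighted_avg_solves:
  assumes b: "b > 0"
    and EPD: "\<And>t. t > 0 \<Longrightarrow> (2 * \<beta> * t powr (l / 2) + (\<alpha> + \<beta> * t) * (l / 2 * t powr (l / 2 - 1))) * phi l t
                = 2 * b * ((\<alpha> + \<beta> * t) * t powr l)"
    and v: "Cm2_closure m \<Omega>\<^sub>\<phi> v"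
    and wave: "\<And>q. q \<in> \<Omega>\<^sub>\<phi> \<Longrightarrow> iter_deriv [t_dir, t_dir] v q = diff_op m a v q"
    and pos0: "\<And>x. x \<in> fst ` \<Omega> \<Longrightarrow> (v \<longlongrightarrow> \<phi> x) (at (x, 0) within \<Omega>\<^sub>\<phi>)"
    and vel0: "\<And>x. x \<in> fst ` \<Omega> \<Longrightarrow> (dir_deriv t_dir v \<longlongrightarrow> 0) (at (x, 0) within \<Omega>\<^sub>\<phi>)"
    and w: "\<And>p. p \<in> \<Omega> \<Longrightarrow> w p = (\<alpha> + \<beta> * snd p) *\<^sub>R avg b 0 v p"
  defines "mass \<equiv> measure (weight_measure b) {0<..<1}"
  shows "Cm2 m \<Omega> w"
    and "\<And>p. p \<in> \<Omega> \<Longrightarrow> iter_deriv [t_dir, t_dir] w p = (snd p powr l) *\<^sub>R diff_op m a w p"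
    and "\<And>x. x \<in> fst ` \<Omega> \<Longrightarrow> (w \<longlongrightarrow> (\<alpha> * mass) *\<^sub>R \<phi> x) (at (x, 0) within \<Omega>)"
    and "\<And>x. x \<in> fst ` \<Omega> \<Longrightarrow> (dir_deriv t_dir w \<longlongrightarrow> (\<beta> * mass) *\<^sub>R \<phi> x) (at (x, 0) within \<Omega>)"
proof -
  let ?e = "t_dir :: (real^'n) \<times> real"
  let ?c = "\<lambda>p :: (real^'n) \<times> real. \<alpha> + \<beta> * snd p"
  define vt where "vt = iter_deriv [?e] v"
  define vtt where "vtt = iter_deriv [?e, ?e] v"
  have vx: "Ck_along (range x_dir) m \<Omega>\<^sub>\<phi> v" and vtime: "Ck_along {?e} 2 \<Omega>\<^sub>\<phi> v"
    using v by (auto simp: Cm2_closure_def Cm2_def)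
  have ext_x: "extends_to_closure (iter_deriv es v)" if "set es \<subseteq> range x_dir" "length es \<le> m" for es
    using v that unfolding Cm2_closure_def extends_to_closure_def by blast
  have ext: "extends_to_closure (iter_deriv es v)" if "set es \<subseteq> {?e}" "length es \<le> 2" for es
    using v that unfolding Cm2_closure_def extends_to_closure_def by blast
  have ext_v: "extends_to_closure v" using ext[of "[]"] by (simp add: iter_deriv_def)
  have ext_vt: "extends_to_closure vt" and ext_vtt: "extends_to_closure vtt"
    using ext[of "[?e]"] ext[of "[?e, ?e]"] by (auto simp: vt_def vtt_def)
  have der_v: "((\<lambda>r. v (q + r *\<^sub>R ?e)) has_vector_derivative vt q) (at 0)" if "q \<in> \<Omega>\<^sub>\<phi>" for q
    using Ck_along_has_vector_derivative[OF vtime, of ?e "[]" q] that by (simp add: vt_def iter_deriv_def)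
  have der_vt: "((\<lambda>r. vt (q + r *\<^sub>R ?e)) has_vector_derivative vtt q) (at 0)" if "q \<in> \<Omega>\<^sub>\<phi>" for q
    using Ck_along_has_vector_derivative[OF vtime, of ?e "[?e]" q] that by (simp add: vt_def vtt_def)
  have cont_c: "continuous_on \<Omega> ?c" by (intro continuous_intros)

  \<comment> \<open>candidates for the iterated derivatives in \<open>x\<close>\<close>
  define X where "X es p = ?c p *\<^sub>R avg b 0 (iter_deriv es v) p" for es p
  have X0: "w p = X [] p" if "p \<in> \<Omega>" for p
    using w[OF that] by (simp add: X_def iter_deriv_def)
  have Xcont: "continuous_on \<Omega> (X es)" if "set es \<subseteq> range x_dir" "length es \<le> m" for es
    unfolding X_def by (intro continuous_on_scaleR cont_c continuous_on_avg b ext_x that)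
  have Xder: "((\<lambda>r. X es (p + r *\<^sub>R e)) has_vector_derivative X (e # es) p) (at 0)"
    if "e \<in> range x_dir" "set es \<subseteq> range x_dir" "length es < m" "p \<in> \<Omega>" for e es p
  proof -
    have e: "snd e = 0" using that(1) by (auto simp: x_dir_def)
    have "((\<lambda>r. avg b 0 (iter_deriv es v) (p + r *\<^sub>R e)) has_vector_derivative
        avg b 0 (iter_deriv (e # es) v) p) (at 0)"
      using that by (intro avg_x_deriv b ext_x Ck_along_has_vector_derivative[OF vx] e) auto
    then show ?thesis
      unfolding X_def using e
      by (auto intro: bounded_linear.has_vector_derivative[OF bounded_linear_scaleR_right])
  qed
  note x_family = Ck_along_family[OF open_domain X0 Xcont Xder, where E = "range x_dir" and k = m]

  \<comment> \<open>\<open>W1\<close> and \<open>W2\<close> are the candidates for the first two time derivatives; \<open>c1'\<close> is the derivative of \<open>c1\<close>.\<close>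
  define c1 where "c1 t = (\<alpha> + \<beta> * t) * t powr (l / 2)" for t
  define c1' where "c1' t = \<beta> * t powr (l / 2) + (\<alpha> + \<beta> * t) * (l / 2 * t powr (l / 2 - 1))" for t
  define W1 where "W1 p = \<beta> *\<^sub>R avg b 0 v p + c1 (snd p) *\<^sub>R avg b 1 vt p" for p
  define W2 where "W2 p = (\<beta> * snd p powr (l / 2)) *\<^sub>R avg b 1 vt p
      + (c1' (snd p) *\<^sub>R avg b 1 vt p + (c1 (snd p) * snd p powr (l / 2)) *\<^sub>R avg b 2 vtt p)" for p
  define T where "T es = (if es = [] then w else if es = [?e] then W1 else W2)" for es
  have snd_e: "snd (p + r *\<^sub>R ?e) = snd p + r" for p :: "(real^'n) \<times> real" and r by (simp add: t_dir_def)
  have d0: "((\<lambda>r. avg b 0 v (p + r *\<^sub>R ?e)) has_vector_derivative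
      (snd p powr (l / 2)) *\<^sub>R avg b 1 vt p) (at 0)" if "p \<in> \<Omega>" for p
    using avg_t_deriv[OF b ext_v ext_vt der_v that, of 0] by simp
  have d1: "((\<lambda>r. avg b 1 vt (p + r *\<^sub>R ?e)) has_vector_derivative
      (snd p powr (l / 2)) *\<^sub>R avg b 2 vtt p) (at 0)" if "p \<in> \<Omega>" for p
    using avg_t_deriv[OF b ext_vt ext_vtt der_vt that, of 1] by (simp add: numeral_2_eq_2)
  have T0: "w p = T [] p" for p by (simp add: T_def)
  have Tder: "((\<lambda>r. T es (p + r *\<^sub>R e)) has_vector_derivative T (e # es) p) (at 0)"
    if "e \<in> {?e}" "set es \<subseteq> {?e}" "length es < 2" and p: "p \<in> \<Omega>" for e es p
  proof -
    from that consider "es = []" | "es = [?e]" by (cases es; cases "tl es") auto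
    then show ?thesis
    proof cases
      case 1
      have "((\<lambda>r. \<alpha> + \<beta> * (snd p + r)) has_real_derivative \<beta>) (at 0)"
        by (auto intro!: derivative_eq_intros)
      from has_vector_derivative_scaleR[OF this d0[OF p]]
      have "((\<lambda>r. ?c (p + r *\<^sub>R ?e) *\<^sub>R avg b 0 v (p + r *\<^sub>R ?e)) has_vector_derivative W1 p) (at 0)"
        unfolding snd_e by (simp add: W1_def c1_def add.commute)
      from dir_deriv_cong_open[OF open_domain p w this] show ?thesis
        using 1 that(1) by (simp add: T_def)
    next
      case 2
      have pos: "snd p > 0" by (rule time_pos[OF p])
      have "((\<lambda>r. c1 (snd p + r)) has_real_derivative c1' (snd p)) (at 0)"
        unfolding c1_def c1'_def using pos
        by (auto intro!: derivative_eq_intros simp: field_simps powr_diff)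
      from has_vector_derivative_add[OF
          bounded_linear.has_vector_derivative[OF bounded_linear_scaleR_right d0[OF p], of \<beta>]
          has_vector_derivative_scaleR[OF this d1[OF p]]]
      have "((\<lambda>r. W1 (p + r *\<^sub>R ?e)) has_vector_derivative W2 p) (at 0)"
        unfolding W1_def W2_def snd_e by (simp add: add_ac)
      then show ?thesis using 2 that(1) by (simp add: T_def)
    qed
  qed
  have Tcont: "continuous_on \<Omega> (T es)" for es
  proof -
    have s: "\<forall>p\<in>\<Omega>. snd p \<noteq> 0" using time_pos by force
    have "continuous_on \<Omega> w" using Xcont[of "[]"] X0 by (simp cong: continuous_on_cong)
    moreover have "continuous_on \<Omega> W1" "continuous_on \<Omega> W2"
      unfolding W1_def W2_def c1_def c1'_def
      by (intro continuous_intros continuous_on_avg b ext_v ext_vt ext_vtt s)+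
    ultimately show ?thesis by (simp add: T_def)
  qed
  note t_family = Ck_along_family[OF open_domain T0 Tcont Tder, where E = "{?e}" and k = 2]

  show "Cm2 m \<Omega> w"
    unfolding Cm2_def using x_family(2) t_family(2) by blast

  show "iter_deriv [?e, ?e] w p = (snd p powr l) *\<^sub>R diff_op m a w p" if p: "p \<in> \<Omega>" for p
  proof -
    have pos: "snd p > 0" by (rule time_pos[OF p])
    have diff_w: "diff_op m a w p = ?c p *\<^sub>R avg b 0 vtt p"
    proof -
      let ?d = "\<lambda>\<alpha>. map x_dir (index_list \<alpha>) :: ((real^'n) \<times> real) list"
      have len: "length (?d \<alpha>) \<le> m" "set (?d \<alpha>) \<subseteq> range x_dir" if "\<alpha> \<in> multi_indices m" for \<alpha>
        using length_index_list[OF that] by auto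
      have "avg b 0 vtt p = (\<integral>s. (\<Sum>\<alpha>\<in>multi_indices m. a \<alpha> (fst p) * iter_deriv (?d \<alpha>) v (ray p s)) \<partial>weight_measure b)"
        unfolding avg_def power_0 scaleR_one
      proof (rule Bochner_Integration.integral_cong[OF refl])
        fix s assume "s \<in> space (weight_measure b)"
        then have "ray p s \<in> \<Omega>\<^sub>\<phi>" using ray_mem[OF p, of s] by simp
        from wave[OF this] show "vtt (ray p s)
            = (\<Sum>\<alpha>\<in>multi_indices m. a \<alpha> (fst p) * iter_deriv (?d \<alpha>) v (ray p s))"
          by (simp add: vtt_def diff_op_def partial_x_def ray_def)
      qed
      also have "\<dots> = (\<Sum>\<alpha>\<in>multi_indices m. a \<alpha> (fst p) * avg b 0 (iter_deriv (?d \<alpha>) v) p)"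
        using integrable_avg[OF b ext_x[OF len(2) len(1)] p, of _ 0]
        by (subst Bochner_Integration.integral_sum) (auto simp: avg_def)
      finally have "?c p *\<^sub>R avg b 0 vtt p = (\<Sum>\<alpha>\<in>multi_indices m. a \<alpha> (fst p) * X (?d \<alpha>) p)"
        by (simp add: X_def scaleR_sum_right)
      also have "\<dots> = diff_op m a w p"
        unfolding diff_op_def partial_x_def
        by (intro sum.cong refl arg_cong2[of _ _ _ _ "(*)"] x_family(1)[symmetric] len p)
      finally show ?thesis by simp
    qed
    have lim: "(vt \<longlongrightarrow> 0) (at (fst p, 0) within \<Omega>\<^sub>\<phi>)"
      using vel0[of "fst p"] p by (simp add: vt_def iter_deriv_def)
    have "iter_deriv [?e, ?e] w p = W2 p"
      using t_family(1)[of "[?e, ?e]" p] p by (simp add: T_def)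
    also have "\<dots> = (?c p * snd p powr l) *\<^sub>R avg b 0 vtt p"
    proof -
      define A where "A = (2 * \<beta> * snd p powr (l / 2) + ?c p * (l / 2 * snd p powr (l / 2 - 1)))"
      define C where "C = ?c p * snd p powr l"
      have AC: "A * phi l (snd p) = 2 * b * C"
        using EPD[OF pos] by (simp add: A_def C_def)
      have cc: "c1 (snd p) * snd p powr (l / 2) = C"
        using powr_half_squared[OF pos, of l] by (simp add: c1_def C_def power2_eq_square)
      have "W2 p = A *\<^sub>R avg b 1 vt p + C *\<^sub>R avg b 2 vtt p"
      proof -
        have "A = \<beta> * snd p powr (l / 2) + c1' (snd p)"
          by (simp add: A_def c1'_def)
        then show ?thesis unfolding W2_def cc by (simp only: scaleR_add_left add.assoc)
      qed
      moreover have "(2 * b) *\<^sub>R (A *\<^sub>R avg b 1 vt p) = (2 * b) *\<^sub>R (C *\<^sub>R (avg b 0 vtt p - avg b 2 vtt p))"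
      proof -
        have "(2 * b) *\<^sub>R (A *\<^sub>R avg b 1 vt p) = A *\<^sub>R ((2 * b) *\<^sub>R avg b 1 vt p)"
          by (simp add: mult.commute)
        also have "\<dots> = (A * phi l (snd p)) *\<^sub>R (avg b 0 vtt p - avg b 2 vtt p)"
          by (subst avg_by_parts[OF b ext_vt ext_vtt der_vt p lim]) simp_all
        finally show ?thesis by (simp add: AC)
      qed
      then have "A *\<^sub>R avg b 1 vt p = C *\<^sub>R (avg b 0 vtt p - avg b 2 vtt p)"
        using b by (simp only: scaleR_cancel_left) simp
      ultimately show ?thesis by (simp add: scaleR_right_diff_distrib flip: C_def)
    qed
    finally show ?thesis
      by (simp add: diff_w mult.commute)
  qed

  have "(w \<longlongrightarrow> (\<alpha> * mass) *\<^sub>R \<phi> x) (at (x, 0) within \<Omega>)"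
    and "(dir_deriv ?e w \<longlongrightarrow> (\<beta> * mass) *\<^sub>R \<phi> x) (at (x, 0) within \<Omega>)"
    if x: "x \<in> fst ` \<Omega>" for x
  proof -
    let ?F = "at (x, 0) within \<Omega>"
    have ev: "eventually (\<lambda>p. p \<in> \<Omega>) ?F" by (simp add: eventually_at_filter)
    have c: "(?c \<longlongrightarrow> \<alpha>) ?F" by (auto intro!: tendsto_eq_intros)
    have avg_v: "(avg b 0 v \<longlongrightarrow> mass *\<^sub>R \<phi> x) ?F"
      using avg_tendsto_bottom[OF b ext_v pos0[OF x], of 0] by (simp add: mass_def)
    have "((\<lambda>p. ?c p *\<^sub>R avg b 0 v p) \<longlongrightarrow> \<alpha> *\<^sub>R mass *\<^sub>R \<phi> x) ?F"
      by (intro tendsto_scaleR c avg_v)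
    then show "(w \<longlongrightarrow> (\<alpha> * mass) *\<^sub>R \<phi> x) ?F"
      by (subst tendsto_cong[OF eventually_mono[OF ev w]]) simp_all
    have "(vt \<longlongrightarrow> 0) (at (x, 0) within \<Omega>\<^sub>\<phi>)"
      using vel0[OF x] by (simp add: vt_def iter_deriv_def)
    then have avg_vt: "(avg b 1 vt \<longlongrightarrow> 0) ?F"
      using avg_tendsto_bottom[OF b ext_vt, of 0 x 1] by simp
    have "((\<lambda>p. c1 (snd p)) \<longlongrightarrow> \<alpha> * 0) ?F"
      unfolding c1_def using l_pos by (intro tendsto_mult c time_powr_tendsto_bottom) simp
    then have "(W1 \<longlongrightarrow> \<beta> *\<^sub>R mass *\<^sub>R \<phi> x + (\<alpha> * 0) *\<^sub>R 0) ?F"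
      unfolding W1_def by (intro tendsto_add tendsto_scaleR tendsto_const avg_v avg_vt)
    moreover have "dir_deriv ?e w p = W1 p" if "p \<in> \<Omega>" for p
      using t_family(1)[of "[?e]" p] that by (simp add: T_def iter_deriv_def)
    ultimately show "(dir_deriv ?e w \<longlongrightarrow> (\<beta> * mass) *\<^sub>R \<phi> x) ?F"
      by (subst tendsto_cong[OF eventually_mono[OF ev]]) auto
  qed
  then show "\<And>x. x \<in> fst ` \<Omega> \<Longrightarrow> (w \<longlongrightarrow> (\<alpha> * mass) *\<^sub>R \<phi> x) (at (x, 0) within \<Omega>)"
    and "\<And>x. x \<in> fst ` \<Omega> \<Longrightarrow> (dir_deriv ?e w \<longlongrightarrow> (\<beta> * mass) *\<^sub>R \<phi> x) (at (x, 0) within \<Omega>)"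
    by blast+
qed

lemma K0_eq_avg:
  assumes "extends_to_closure v" "p \<in> \<Omega>"
  shows "K0 l v p = (2 powr (2 - 2 * gam l) * (Gamma (2 * gam l) / (Gamma (gam l))\<^sup>2)) *\<^sub>R avg (gam l) 0 v p"
proof -
  have "(\<lambda>s. v (ray p s)) \<in> borel_measurable (restrict_space borel {0<..<1})"
    using measurable_avg[OF assms, of 0] by (simp add: measurable_weight_measure)
  from integral_weight_measure[OF this, of "gam l"] show ?thesis
    by (simp add: K0_def avg_def ray_def case_prod_unfold LINT_Icc_eq_Ioo)
qed

lemma K1_eq_avg:
  assumes "extends_to_closure v" "p \<in> \<Omega>"
  shows "K1 l v p = (2 powr (2 * gam l) * (Gamma (2 - 2 * gam l) / (Gamma (1 - gam l))\<^sup>2) * snd p)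
            *\<^sub>R avg (1 - gam l) 0 v p"
proof -
  have "(\<lambda>s. v (ray p s)) \<in> borel_measurable (restrict_space borel {0<..<1})"
    using measurable_avg[OF assms, of 0] by (simp add: measurable_weight_measure)
  from integral_weight_measure[OF this, of "1 - gam l"] show ?thesis
    by (simp add: K1_def avg_def ray_def case_prod_unfold LINT_Icc_eq_Ioo mult_ac)
qed

end

theorem theorem1p8:
  fixes l :: real and m :: nat
    and \<Omega> :: "((real^'n) \<times> real) set"
    and a :: "('n \<Rightarrow> nat) \<Rightarrow> real^'n \<Rightarrow> complex"
    and \<phi>0 \<phi>1 :: "real^'n \<Rightarrow> complex"
    and v0 v1 u :: "(real^'n) \<times> real \<Rightarrow> complex"
  assumes "l > 0"
    and "\<Omega> \<subseteq> upper_half_space" and "open \<Omega>" and "connected \<Omega>"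
    and "backward_time_connected \<Omega>"
    and "\<And>\<alpha>. \<alpha> \<in> multi_indices m \<Longrightarrow> Cinf (fst ` \<Omega>) (a \<alpha>)"
    and "Cm2_closure m (phi_image l \<Omega>) v0"
    and "\<And>x t. (x, t) \<in> phi_image l \<Omega> \<Longrightarrow>
           iter_deriv [t_dir, t_dir] v0 (x, t) - diff_op m a v0 (x, t) = 0"
    and "\<And>x. x \<in> fst ` \<Omega> \<Longrightarrow> (v0 \<longlongrightarrow> \<phi>0 x) (at (x, 0) within phi_image l \<Omega>)"
    and "\<And>x. x \<in> fst ` \<Omega> \<Longrightarrow> (dir_deriv t_dir v0 \<longlongrightarrow> 0) (at (x, 0) within phi_image l \<Omega>)"
    and "Cm2_closure m (phi_image l \<Omega>) v1"
    and "\<And>x t. (x, t) \<in> phi_image l \<Omega> \<Longrightarrow>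
           iter_deriv [t_dir, t_dir] v1 (x, t) - diff_op m a v1 (x, t) = 0"
    and "\<And>x. x \<in> fst ` \<Omega> \<Longrightarrow> (v1 \<longlongrightarrow> \<phi>1 x) (at (x, 0) within phi_image l \<Omega>)"
    and "\<And>x. x \<in> fst ` \<Omega> \<Longrightarrow> (dir_deriv t_dir v1 \<longlongrightarrow> 0) (at (x, 0) within phi_image l \<Omega>)"
    and "u = (\<lambda>p. K0 l v0 p + K1 l v1 p)"
  shows "Cm2 m \<Omega> u
    \<and> (\<forall>x t. (x, t) \<in> \<Omega> \<longrightarrow>
         iter_deriv [t_dir, t_dir] u (x, t) - (t powr l) *\<^sub>R diff_op m a u (x, t) = 0)
    \<and> (\<forall>x\<in>fst ` \<Omega>. (u \<longlongrightarrow> \<phi>0 x) (at (x, 0) within \<Omega>)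
         \<and> (dir_deriv t_dir u \<longlongrightarrow> \<phi>1 x) (at (x, 0) within \<Omega>))"
proof -
  interpret backward_domain l \<Omega>
    using assms(1-3,5) by unfold_locales
  let ?\<gamma> = "gam l" and ?e = "t_dir :: (real^'n) \<times> real"
  define C0 where "C0 = 2 powr (2 - 2 * ?\<gamma>) * (Gamma (2 * ?\<gamma>) / (Gamma ?\<gamma>)\<^sup>2)"
  define C1 where "C1 = 2 powr (2 * ?\<gamma>) * (Gamma (2 - 2 * ?\<gamma>) / (Gamma (1 - ?\<gamma>))\<^sup>2)"
  have \<gamma>: "0 < ?\<gamma>" "0 < 1 - ?\<gamma>" using \<open>l > 0\<close> by (auto simp: gam_def field_simps)
  have C0: "C0 * measure (weight_measure ?\<gamma>) {0<..<1} = 1"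
    using normalization_constant[OF \<gamma>(1)] unfolding C0_def .
  have C1: "C1 * measure (weight_measure (1 - ?\<gamma>)) {0<..<1} = 1"
  proof -
    have "2 - 2 * (1 - ?\<gamma>) = 2 * ?\<gamma>" "2 * (1 - ?\<gamma>) = 2 - 2 * ?\<gamma>" by simp_all
    then show ?thesis using normalization_constant[OF \<gamma>(2)] unfolding C1_def by metis
  qed
  have extends_to_closure: "extends_to_closure v" if "Cm2_closure m \<Omega>\<^sub>\<phi> v" for v
    using that[unfolded Cm2_closure_def, THEN conjunct2, rule_format, of "[]"]
    by (simp add: extends_to_closure_def iter_deriv_def)
  have epd0: "(2 * 0 * t powr (l / 2) + (C0 + 0 * t) * (l / 2 * t powr (l / 2 - 1))) * phi l t
      = 2 * ?\<gamma> * ((C0 + 0 * t) * t powr l)" if "t > 0" for t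
    using powr_times_phi(2)[OF \<open>l > 0\<close> that] \<open>l > 0\<close> by (simp add: gam_def mult_ac)
  have epd1: "(2 * C1 * t powr (l / 2) + (0 + C1 * t) * (l / 2 * t powr (l / 2 - 1))) * phi l t
      = 2 * (1 - ?\<gamma>) * ((0 + C1 * t) * t powr l)" if "t > 0" for t
  proof -
    have "(2 * C1 * t powr (l / 2) + (0 + C1 * t) * (l / 2 * t powr (l / 2 - 1))) * phi l t
        = 2 * C1 * (t powr (l / 2) * phi l t) + C1 * t * (l / 2) * (t powr (l / 2 - 1) * phi l t)"
      by (simp add: algebra_simps)
    also have "\<dots> = (4 / (l + 2) + l / (l + 2)) * (C1 * (t * t powr l))"
      unfolding powr_times_phi[OF \<open>l > 0\<close> that] by (simp add: algebra_simps)
    also have "4 / (l + 2) + l / (l + 2) = 2 * (1 - ?\<gamma>)"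
    proof -
      have "2 * ?\<gamma> = l / (l + 2)" using \<open>l > 0\<close> by (simp add: gam_def divide_simps)
      then have "2 * (1 - ?\<gamma>) = 2 - l / (l + 2)" by (simp add: right_diff_distrib)
      also have "2 - l / (l + 2) = 4 / (l + 2) + l / (l + 2)" using \<open>l > 0\<close>
        by (simp add: divide_simps, simp add: algebra_simps)
      finally show ?thesis by simp
    qed
    finally show ?thesis by simp
  qed
  have w0: "K0 l v0 p = (C0 + 0 * snd p) *\<^sub>R avg ?\<gamma> 0 v0 p" if "p \<in> \<Omega>" for p
    using K0_eq_avg[OF extends_to_closure[OF assms(7)] that] by (simp add: C0_def)
  have w1: "K1 l v1 p = (0 + C1 * snd p) *\<^sub>R avg (1 - ?\<gamma>) 0 v1 p" if "p \<in> \<Omega>" for p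
    using K1_eq_avg[OF extends_to_closure[OF assms(11)] that] by (simp add: C1_def)
  have wave0: "iter_deriv [?e, ?e] v0 q = diff_op m a v0 q" if "q \<in> \<Omega>\<^sub>\<phi>" for q
    using assms(8)[of "fst q" "snd q"] that by simp
  have wave1: "iter_deriv [?e, ?e] v1 q = diff_op m a v1 q" if "q \<in> \<Omega>\<^sub>\<phi>" for q
    using assms(12)[of "fst q" "snd q"] that by simp
  have s0: "Cm2 m \<Omega> (K0 l v0)"
    "\<And>p. p \<in> \<Omega> \<Longrightarrow> iter_deriv [?e, ?e] (K0 l v0) p = (snd p powr l) *\<^sub>R diff_op m a (K0 l v0) p"
    "\<And>x. x \<in> fst ` \<Omega> \<Longrightarrow> (K0 l v0 \<longlongrightarrow> \<phi>0 x) (at (x, 0) within \<Omega>)"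
    "\<And>x. x \<in> fst ` \<Omega> \<Longrightarrow> (dir_deriv ?e (K0 l v0) \<longlongrightarrow> 0) (at (x, 0) within \<Omega>)"
    using weighted_avg_solves[OF \<gamma>(1) epd0 assms(7) wave0 assms(9,10) w0] C0 by simp_all
  have s1: "Cm2 m \<Omega> (K1 l v1)"
    "\<And>p. p \<in> \<Omega> \<Longrightarrow> iter_deriv [?e, ?e] (K1 l v1) p = (snd p powr l) *\<^sub>R diff_op m a (K1 l v1) p"
    "\<And>x. x \<in> fst ` \<Omega> \<Longrightarrow> (K1 l v1 \<longlongrightarrow> 0) (at (x, 0) within \<Omega>)"
    "\<And>x. x \<in> fst ` \<Omega> \<Longrightarrow> (dir_deriv ?e (K1 l v1) \<longlongrightarrow> \<phi>1 x) (at (x, 0) within \<Omega>)"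
    using weighted_avg_solves[OF \<gamma>(2) epd1 assms(11) wave1 assms(13,14) w1] C1 by simp_all
  have tt: "iter_deriv es u p = iter_deriv es (K0 l v0) p + iter_deriv es (K1 l v1) p"
    if "set es \<subseteq> {?e}" "length es \<le> 2" "p \<in> \<Omega>" for es p
    unfolding assms(15) using s0(1) s1(1) that
    by (intro iter_deriv_add[OF open_domain]) (auto simp: Cm2_def)
  show ?thesis
  proof (intro conjI allI ballI impI)
    show "Cm2 m \<Omega> u"
      unfolding assms(15) by (rule Cm2_add[OF open_domain s0(1) s1(1)])
  next
    fix x t assume xt: "(x, t) \<in> \<Omega>"
    show "iter_deriv [?e, ?e] u (x, t) - (t powr l) *\<^sub>R diff_op m a u (x, t) = 0"
      using tt[of "[?e, ?e]" "(x, t)"] xt s0(2)[OF xt] s1(2)[OF xt]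
      by (simp add: assms(15) diff_op_add[OF open_domain s0(1) s1(1) xt] scaleR_add_right)
  next
    fix x assume x: "x \<in> fst ` \<Omega>"
    show "(u \<longlongrightarrow> \<phi>0 x) (at (x, 0) within \<Omega>)"
      using tendsto_add[OF s0(3)[OF x] s1(3)[OF x]] by (simp add: assms(15))
    have "((\<lambda>p. dir_deriv ?e (K0 l v0) p + dir_deriv ?e (K1 l v1) p) \<longlongrightarrow> \<phi>1 x) (at (x, 0) within \<Omega>)"
      using tendsto_add[OF s0(4)[OF x] s1(4)[OF x]] by simp
    moreover have "eventually (\<lambda>p. dir_deriv ?e u p = dir_deriv ?e (K0 l v0) p + dir_deriv ?e (K1 l v1) p)
        (at (x, 0) within \<Omega>)"
      unfolding eventually_at_filter using tt[of "[?e]"]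
      by (intro always_eventually) (auto simp: iter_deriv_def)
    ultimately show "(dir_deriv ?e u \<longlongrightarrow> \<phi>1 x) (at (x, 0) within \<Omega>)"
      by (subst tendsto_cong) auto
  qed
qed

end
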